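(* Let $\Lambda=(\lambda_n)_{n\in\mathbb N}$ be an $r$-lacunary sequence ($r>1$), let $\mu$ be a positive finite measure on $[0,1)$ and let $p\in[1,+\infty)$. Assume that $\mu$ satisfies $(B_p)$, i.e. there is a constant $C'$ such that $\int_{[0,1)}t^{p\lambda_n}d\mu\le\frac{C'}{\lambda_n}$ for all $n\in\mathbb N$. Then $\mu$ is a Carleson measure for $M_\Lambda^q$ for any $q>p$. Moreover, $$\|i_\mu^q\|\le C\Big(\sup_{n\in\mathbb N}\lambda_n\int_{[0,1)}t^{p\lambda_n}d\mu\Big)^{\frac1q},$$ where $C$ depends only on $p$, $q$ and $\Lambda$.
   Context: A sequence $(\lambda_n)_n$ of positive numbers is $r$-lacunary if $\lambda_{n+1}\ge r\lambda_n$ for every $n$. $M_\Lambda^q$ is the closed linear span of the monomials $t^{\lambda_n}$ in $L^q([0,1],m)$, $m$ the Lebesgue measure, with norm $\|\cdot\|_q$; by the Clarkson–Erdős theorem every $f\in M_\Lambda^q$ has well-defined values $f(x)=\sum_na_nx^{\lambda_n}$ at each $x\in[0,1)$. $\mu$ is a Carleson measure for $M_\Lambda^q$ if there is a constant $c$ such that $\|f\|_{L^q(\mu)}\le c\|f\|_q$ for every Müntz polynomial $f(t)=\sum_na_nt^{\lambda_n}$ (finite sum); in that case $i_\mu^q:M_\Lambda^q\to L^q(\mu)$, $f\mapsto f$, is the resulting bounded embedding and $\|i_\mu^q\|$ its operator norm. *)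

theory Defs
  imports "HOL-Analysis.Analysis"
begin

definition lacunary :: "real \<Rightarrow> (nat \<Rightarrow> real) \<Rightarrow> bool" where
  "lacunary r \<Lambda> \<longleftrightarrow> (\<forall>n. 0 < \<Lambda> n) \<and> (\<forall>n. r * \<Lambda> n \<le> \<Lambda> (Suc n))"

definition leb01 :: "real measure" where
  "leb01 = restrict_space lborel {0..1}"

text \<open>The norm of \<open>L\<^sup>q(M)\<close> for a finite exponent \<open>q\<close>, with value \<open>\<infinity>\<close> exactly when
  the integral of \<open>|f|\<^sup>q\<close> diverges.\<close>

definition Lq_norm :: "'a measure \<Rightarrow> real \<Rightarrow> ('a \<Rightarrow> complex) \<Rightarrow> ennreal" where
  "Lq_norm M q f =
    (let I = (\<integral>\<^sup>+ x. ennreal (norm (f x) powr q) \<partial>M)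
     in if I = \<infinity> then \<infinity> else ennreal (enn2real I powr (1 / q)))"

definition muntz_polynomials :: "(nat \<Rightarrow> real) \<Rightarrow> (real \<Rightarrow> complex) set" where
  "muntz_polynomials \<Lambda> =
    {f. \<exists>a N. f = (\<lambda>t. \<Sum>n<N. a n * complex_of_real (t powr \<Lambda> n))}"

text \<open>An element of the closed span of the monomials in \<open>L\<^sup>q([0,1])\<close> is a class of functions
  modulo null sets. It is represented here by the function of the class whose values on
  \<open>[0,1)\<close> are \<open>f(x) = \<Sum> a\<^sub>n x\<^bsup>\<lambda>\<^sub>n\<^esup>\<close>; by the Clarkson--Erdos theorem every class has such a
  representative, and by continuity only one on \<open>[0,1)\<close>. Values of \<open>f\<close> outside \<open>[0,1)\<close>
  are irrelevant.\<close>

definition muntz_space :: "(nat \<Rightarrow> real) \<Rightarrow> real \<Rightarrow> (real \<Rightarrow> complex) set" where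
  "muntz_space \<Lambda> q =
    {f \<in> borel_measurable leb01.
       (\<forall>\<epsilon>>0. \<exists>g \<in> muntz_polynomials \<Lambda>. Lq_norm leb01 q (\<lambda>t. f t - g t) < \<epsilon>) \<and>
       (\<exists>a. \<forall>x\<in>{0..<1}. (\<lambda>n. a n * complex_of_real (x powr \<Lambda> n)) sums f x)}"

definition carleson_measure :: "(nat \<Rightarrow> real) \<Rightarrow> real \<Rightarrow> real measure \<Rightarrow> bool" where
  "carleson_measure \<Lambda> q \<mu> \<longleftrightarrow>
    (\<exists>c::real. \<forall>f \<in> muntz_polynomials \<Lambda>. Lq_norm \<mu> q f \<le> ennreal c * Lq_norm leb01 q f)"

text \<open>The operator norm of the embedding \<open>f \<mapsto> f\<close> of the Muntz space into \<open>L\<^sup>q(\<mu>)\<close>, for a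
  measure \<open>\<mu>\<close> on \<open>[0,1)\<close>. It is extended-valued, so that it equals \<open>\<infinity>\<close> if the embedding
  is not bounded.\<close>

definition embedding_norm :: "(nat \<Rightarrow> real) \<Rightarrow> real \<Rightarrow> real measure \<Rightarrow> ennreal" where
  "embedding_norm \<Lambda> q \<mu> = (SUP f \<in> {f \<in> muntz_space \<Lambda> q. Lq_norm leb01 q f \<le> 1}. Lq_norm \<mu> q f)"

definition cond_B :: "real \<Rightarrow> (nat \<Rightarrow> real) \<Rightarrow> real measure \<Rightarrow> bool" where
  "cond_B p \<Lambda> \<mu> \<longleftrightarrow> (\<exists>C'. \<forall>n. (LINT t|\<mu>. t powr (p * \<Lambda> n)) \<le> C' / \<Lambda> n)"

end

theory Submission
  imports Defs "HOL-Probability.Distributions"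
begin

text \<open>The proof compares both norms of a Muntz polynomial with the sequence norm
  \<open>N(a) = \<Sum> |a\<^sub>n|\<^sup>q / \<lambda>\<^sub>n\<close>.

  Lower bound (Gurariy--Macaev): \<open>N(a) \<le> C \<parallel>f\<parallel>\<^sub>q\<^sup>q\<close>. After substituting \<open>t = e\<^sup>-\<^sup>x\<close>, pair \<open>f\<close> with
  dilates \<open>\<lambda>\<^sub>m k(\<lambda>\<^sub>m x)\<close> of a kernel whose Laplace transform is \<open>(4s / (1 + s)\<^sup>2)\<^sup>N\<close>. This
  function is \<open>1\<close> at \<open>s = 1\<close> and, for large \<open>N\<close>, so small at the other ratios \<open>\<lambda>\<^sub>n / \<lambda>\<^sub>m\<close> of a lacunary
  sequence that the matrix taking \<open>a\<close> to the pairings is diagonally dominant; Jensen's inequality bounds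
  the pairings by \<open>\<parallel>f\<parallel>\<^sub>q\<close>.

  Upper bound: \<open>\<integral> |f|\<^sup>q d\<mu> \<le> C S N(a)\<close>, where \<open>S\<close> is the supremum in the statement. At \<open>t = e\<^sup>-\<^sup>x\<close> split the sum at
  \<open>\<lambda>\<^sub>n x = 1\<close> and use Jensen's inequality with geometric weights on each part. This gives
  \<open>|f(t)|\<^sup>q \<le> C \<Sum>\<^sub>n |a\<^sub>n|\<^sup>q / \<lambda>\<^sub>n \<Sum>\<^sub>k\<^sub>\<ge>\<^sub>n (\<lambda>\<^sub>n / \<lambda>\<^sub>k)\<^sup>1\<^sup>/\<^sup>2 \<lambda>\<^sub>k t\<^bsup>p\<lambda>\<^sub>k\<^esup>\<close>, which is integrated termwise. The strict
  inequality \<open>p < q\<close> is what controls the high frequencies.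

  For a general element of the Muntz space the lower bound is applied to partial sums of
  the dilates \<open>f(\<rho>t)\<close>, which converge uniformly on \<open>[0,1]\<close>, and the upper bound is passed to the limit by
  Fatou's lemma.\<close>

section \<open>Jensen's inequality and elementary estimates\<close>

text \<open>By convexity the graph of \<open>u powr q\<close> lies above its tangent at
  \<open>c\<close>. The tangent theorem is applied on \<open>{0<..}\<close>, so \<open>u = 0\<close>
  is treated separately; there the left side is \<open>(1 - q) * c powr q \<le> 0\<close>.\<close>

lemma powr_ge_tangent:
  fixes u c q :: real
  assumes "1 \<le> q" "0 \<le> u" "0 < c"
  shows "c powr q + q * c powr (q - 1) * (u - c) \<le> u powr q"
proof (cases "u = 0")
  case True
  have "c powr q = c powr (q - 1) * c"
    using assms by (simp add: powr_diff)
  then show ?thesis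
    using True assms by (simp add: algebra_simps mult_left_mono)
next
  case False
  have conv: "convex_on {0<..} (\<lambda>x. x powr q)"
    using powr_convex[of q] assms by (auto intro: convex_on_subset)
  have "((\<lambda>x. x powr q) has_real_derivative q * c powr (q - 1)) (at c within {0<..})"
    using assms by (auto intro!: derivative_eq_intros simp: powr_diff)
  from convex_on_imp_above_tangent[OF conv _ _ _ this, of u] show ?thesis
    using False assms by (simp add: connected_iff_interval interior_open)
qed

text \<open>Jensen's inequality for the density \<open>w\<close>, without normalising its mass
  \<open>W\<close>. The tangent inequality is taken at the mean \<open>c = I / W\<close> and
  integrated against \<open>w\<close>; the linear term then integrates to zero.\<close>

lemma integral_mult_powr_le:
  fixes w u :: "'a \<Rightarrow> real"
  assumes q: "1 \<le> q"
    and int: "integrable M w" "integrable M (\<lambda>x. w x * u x)" "integrable M (\<lambda>x. w x * u x powr q)"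
    and w: "\<And>x. x \<in> space M \<Longrightarrow> 0 \<le> w x" and u: "\<And>x. x \<in> space M \<Longrightarrow> 0 \<le> u x"
  shows "(\<integral>x. w x * u x \<partial>M) powr q
    \<le> (\<integral>x. w x \<partial>M) powr (q - 1) * (\<integral>x. w x * u x powr q \<partial>M)"
proof -
  define W I c where "W = (\<integral>x. w x \<partial>M)" and "I = (\<integral>x. w x * u x \<partial>M)" and "c = I / W"
  have rhs: "0 \<le> (\<integral>x. w x * u x powr q \<partial>M)"
    by (rule Bochner_Integration.integral_nonneg) (use w in auto)
  have "0 \<le> W" unfolding W_def
    by (rule Bochner_Integration.integral_nonneg) (use w in auto)
  have "0 \<le> I" unfolding I_def
    by (rule Bochner_Integration.integral_nonneg) (use w u in auto)
  show ?thesis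
  proof (cases "I = 0")
    case True
    then show ?thesis using rhs by (auto simp: I_def)
  next
    case False
    have "W \<noteq> 0"
    proof
      assume "W = 0"
      then have "AE x in M. w x = 0"
        using integral_nonneg_eq_0_iff_AE[OF int(1)] w by (auto simp: W_def)
      then have "I = (\<integral>x. 0 \<partial>M)"
        unfolding I_def using int by (intro integral_cong_AE) auto
      with False show False by simp
    qed
    with \<open>0 \<le> W\<close> \<open>0 \<le> I\<close> False have pos: "0 < W" "0 < I" "0 < c"
      by (auto simp: c_def)
    have "c powr q * W = c powr q * W + q * c powr (q - 1) * (I - c * W)"
      using pos by (simp add: c_def)
    also have "\<dots> = (\<integral>x. c powr q * w x + q * c powr (q - 1) * (w x * u x - c * w x) \<partial>M)"
      using int by (simp add: W_def I_def)
    also have "\<dots> \<le> (\<integral>x. w x * u x powr q \<partial>M)"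
    proof (rule integral_mono)
      fix x assume x: "x \<in> space M"
      have "w x * (c powr q + q * c powr (q - 1) * (u x - c)) \<le> w x * u x powr q"
        using powr_ge_tangent[OF q u[OF x] \<open>0 < c\<close>] w[OF x] by (rule mult_left_mono)
      then show "c powr q * w x + q * c powr (q - 1) * (w x * u x - c * w x) \<le> w x * u x powr q"
        by (simp add: algebra_simps)
    qed (use int in auto)
    finally have "c powr q * W \<le> (\<integral>x. w x * u x powr q \<partial>M)" .
    moreover have "I powr q = W powr (q - 1) * (c powr q * W)"
      using pos by (simp add: c_def powr_divide powr_diff)
    ultimately show ?thesis
      by (simp add: I_def[symmetric] W_def[symmetric] mult_left_mono)
  qed
qed

lemma sum_mult_powr_le:
  fixes w u :: "'a \<Rightarrow> real"
  assumes "1 \<le> q" "finite A" "\<And>x. x \<in> A \<Longrightarrow> 0 \<le> w x" "\<And>x. x \<in> A \<Longrightarrow> 0 \<le> u x"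
  shows "(\<Sum>x\<in>A. w x * u x) powr q \<le> (\<Sum>x\<in>A. w x) powr (q - 1) * (\<Sum>x\<in>A. w x * u x powr q)"
  using integral_mult_powr_le[of q "count_space A" w u] assms
  by (simp add: lebesgue_integral_count_space_finite integrable_count_space)

lemma add_powr_le:
  fixes u v :: real
  assumes "1 \<le> q" "0 \<le> u" "0 \<le> v"
  shows "(u + v) powr q \<le> 2 powr (q - 1) * (u powr q + v powr q)"
  using sum_mult_powr_le[of q "{False, True}" "\<lambda>_. 1" "\<lambda>b. if b then u else v"] assms
  by (simp add: add.commute)

text \<open>Raise \<open>y / s \<le> exp (y / s)\<close> to the power \<open>s\<close>.\<close>

lemma powr_mult_exp_minus_le:
  fixes y s :: real
  assumes "0 < s" "0 \<le> y"
  shows "y powr s * exp (- y) \<le> s powr s"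
proof (cases "y = 0")
  case False
  have "y / s \<le> exp (y / s)"
    using exp_ge_add_one_self[of "y / s"] by linarith
  then have "y \<le> s * exp (y / s)"
    using assms by (simp add: field_simps)
  then have "y powr s \<le> (s * exp (y / s)) powr s"
    using assms by (intro powr_mono2) auto
  also have "\<dots> = s powr s * exp y"
    using assms by (simp add: powr_mult exp_powr_real)
  finally show ?thesis
    by (simp add: exp_minus field_simps)
qed (use assms in auto)

section \<open>Sums along lacunary sequences\<close>

lemma lacunary_pos: "lacunary r z \<Longrightarrow> 0 < z n"
  by (simp add: lacunary_def)

text \<open>Powers of a lacunary sequence serve as geometric weights below; for \<open>1 < r\<close>
  the new ratio \<open>r powr s\<close> exceeds \<open>1\<close> again.\<close>

lemma lacunary_powr:
  assumes "lacunary r z" "0 < r" "0 < s" "0 < c"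
  shows "lacunary (r powr s) (\<lambda>n. c * z n powr s)"
proof -
  have "r powr s * (c * z n powr s) \<le> c * z (Suc n) powr s" for n
  proof -
    have "r powr s * z n powr s = (r * z n) powr s"
      using assms lacunary_pos[OF assms(1), of n] by (simp add: powr_mult)
    also have "\<dots> \<le> z (Suc n) powr s"
      using assms lacunary_pos[OF assms(1), of n]
      by (intro powr_mono2) (auto simp: lacunary_def less_imp_le)
    finally show ?thesis
      using assms by (simp add: mult.left_commute)
  qed
  then show ?thesis
    using assms(4) lacunary_pos[OF assms(1)] by (auto simp: lacunary_def less_le)
qed

lemma lacunary_mult: "lacunary r z \<Longrightarrow> 0 < c \<Longrightarrow> lacunary r (\<lambda>n. c * z n)"
  by (auto simp: lacunary_def mult.left_commute)

lemma lacunary_less: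
  assumes "lacunary r z" "1 < r" "m < n"
  shows "r * z m \<le> z n"
  using \<open>m < n\<close>
proof (induction n)
  case (Suc n)
  have "z n \<le> r * z n"
    using lacunary_pos[OF assms(1), of n] assms(2) by simp
  moreover have "r * z n \<le> z (Suc n)"
    using assms(1) by (simp add: lacunary_def)
  ultimately show ?case
    using Suc by (cases "m = n") auto
qed simp

lemma lacunary_mono: "lacunary r z \<Longrightarrow> 1 < r \<Longrightarrow> m \<le> n \<Longrightarrow> z m \<le> z n"
  using lacunary_less[of r z m n] lacunary_pos[of r z m] mult_right_mono[of 1 r "z m"]
  by (cases "m = n") (simp, linarith)

text \<open>The last term dominates as in a geometric series. The constant
  \<open>K = r / (r - 1)\<close> solves \<open>K / r + 1 = K\<close>, which is what the induction
  step needs.\<close>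

lemma lacunary_sum_le:
  assumes "lacunary r z" "1 < r"
  shows "(\<Sum>n\<le>k. z n) \<le> r / (r - 1) * z k"
proof (induction k)
  case 0
  then show ?case
    using assms lacunary_pos[OF assms(1), of 0] by (simp add: field_simps)
next
  case (Suc k)
  have "r * z k \<le> z (Suc k)"
    using assms(1) by (simp add: lacunary_def)
  then have "r / (r - 1) * z k + z (Suc k) \<le> 1 / (r - 1) * z (Suc k) + z (Suc k)"
    using assms(2) by (simp add: divide_right_mono)
  also have "\<dots> = r / (r - 1) * z (Suc k)"
    using assms(2) by (simp add: field_simps)
  finally have "r / (r - 1) * z k + z (Suc k) \<le> r / (r - 1) * z (Suc k)" .
  with Suc show ?case by simp
qed

text \<open>Lacunarity gives \<open>1 / z n \<le> r / (r - 1) * (1 / z n - 1 / z (Suc n))\<close>,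
  and the right side telescopes.\<close>

lemma lacunary_sum_inverse_le:
  assumes "lacunary r z" "1 < r"
  shows "(\<Sum>n\<in>{j..<N}. 1 / z n) \<le> r / (r - 1) / z j"
proof (cases "j < N")
  case True
  have pos: "0 < z n" for n using lacunary_pos[OF assms(1)] .
  have step: "r * z n \<le> z (Suc n)" for n
    using assms(1) by (simp add: lacunary_def)
  have "(\<Sum>n\<in>{j..<N}. 1 / z n) \<le> (\<Sum>n\<in>{j..<N}. r / (r - 1) * (1 / z n - 1 / z (Suc n)))"
  proof (rule sum_mono)
    fix n
    define \<alpha> \<beta> where "\<alpha> = 1 / z n" and "\<beta> = 1 / z (Suc n)"
    have "1 / z (Suc n) \<le> 1 / (r * z n)"
      using step[of n] pos[of n] pos[of "Suc n"] assms(2)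
      by (intro divide_left_mono mult_pos_pos) auto
    then have "\<beta> \<le> \<alpha> / r"
      by (simp add: \<alpha>_def \<beta>_def mult.commute[of r])
    then have "\<alpha> \<le> r / (r - 1) * (\<alpha> - \<beta>)"
      using assms(2) by (simp add: field_simps)
    then show "1 / z n \<le> r / (r - 1) * (1 / z n - 1 / z (Suc n))"
      by (simp add: \<alpha>_def \<beta>_def)
  qed
  also have "\<dots> = r / (r - 1) * (1 / z j - 1 / z N)"
    using True sum_Suc_diff'[of j N "\<lambda>n. - (1 / z n)"]
    unfolding sum_distrib_left[symmetric] by simp
  also have "\<dots> \<le> r / (r - 1) * (1 / z j)"
    using pos[of N] assms(2) by (intro mult_left_mono) auto
  finally show ?thesis by simp
qed (use assms lacunary_pos[OF assms(1), of j] in auto)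

text \<open>Compare with the telescoping increments
  \<open>1 / (1 + x) - 1 / (1 + y) = (y - x) / ((1 + x) * (1 + y))\<close>; a lacunary jump from
  \<open>x\<close> to \<open>y\<close> has \<open>y \<le> r / (r - 1) * (y - x)\<close>. Rescaling
  \<open>z\<close> leaves the bound unchanged, so it later serves all ratios
  \<open>z n / z m\<close> and all points \<open>x\<close> uniformly.\<close>

lemma lacunary_sum_frac_le:
  assumes "lacunary r z" "1 < r"
  shows "(\<Sum>n<N. z n / (1 + z n)\<^sup>2) \<le> r / (r - 1)"
proof -
  have pos: "0 < z n" for n using lacunary_pos[OF assms(1)] .
  have main: "(\<Sum>n\<le>k. z n / (1 + z n)\<^sup>2) \<le> r / (r - 1) * (1 - 1 / (1 + z k))" for k
  proof (induction k)
    case 0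
    have "z 0 / (1 + z 0)\<^sup>2 \<le> z 0 / (1 + z 0)"
      using pos[of 0] unfolding power2_eq_square
      by (intro divide_left_mono mult_pos_pos) (auto simp: algebra_simps)
    also have "\<dots> \<le> r / (r - 1) * (z 0 / (1 + z 0))"
      using pos[of 0] assms(2) by (intro mult_le_cancel_right1[THEN iffD2]) (auto simp: field_simps)
    also have "z 0 / (1 + z 0) = 1 - 1 / (1 + z 0)"
      using pos[of 0] by (simp add: field_simps)
    finally show ?case by simp
  next
    case (Suc k)
    let ?x = "z k" and ?y = "z (Suc k)"
    have xy: "r * ?x \<le> ?y" "0 < ?x" "0 < ?y"
      using assms(1) pos by (auto simp: lacunary_def)
    have "?x \<le> ?y"
      using lacunary_mono[OF assms, of k "Suc k"] by simp
    have "?y / (1 + ?y)\<^sup>2 \<le> ?y / ((1 + ?x) * (1 + ?y))"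
      using xy \<open>?x \<le> ?y\<close> unfolding power2_eq_square
      by (intro divide_left_mono mult_right_mono) auto
    also have "?y \<le> r / (r - 1) * (?y - ?x)"
      using xy(1) assms(2) by (simp add: field_simps)
    then have "?y / ((1 + ?x) * (1 + ?y)) \<le> r / (r - 1) * (?y - ?x) / ((1 + ?x) * (1 + ?y))"
      using xy by (intro divide_right_mono) auto
    also have "\<dots> = r / (r - 1) * (1 / (1 + ?x) - 1 / (1 + ?y))"
      using xy by (simp add: divide_simps)
    finally show ?case
      using Suc by (simp add: algebra_simps)
  qed
  show ?thesis
  proof (cases N)
    case (Suc k)
    have "r / (r - 1) * (1 - 1 / (1 + z k)) \<le> r / (r - 1)"
      using pos[of k] assms(2) by (intro mult_right_le_one_le) (auto simp: field_simps)
    with main[of k] Suc show ?thesis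
      by (simp add: lessThan_Suc_atMost)
  qed (use assms in simp)
qed

text \<open>Since \<open>exp (- y) \<le> D / (1 + y powr s)\<^sup>2\<close>, the sum reduces to
  \<open>lacunary_sum_frac_le\<close> for the sequence \<open>(b * x * z n) powr s\<close>. That
  bound is free of scale, which is why \<open>C\<close> depends on none of \<open>z\<close>,
  \<open>x\<close> and \<open>N\<close>.\<close>

lemma lacunary_sum_powr_exp_le:
  assumes "1 < r" "0 < s" "0 < b"
  shows "\<exists>C>0. \<forall>z x N. lacunary r z \<longrightarrow> 0 < x \<longrightarrow>
    (\<Sum>n<N. (z n * x) powr s * exp (- (b * z n * x))) \<le> C"
proof -
  \<comment> \<open>The outer \<open>2\<close> comes from expanding the square
    \<open>(1 + y powr s)\<^sup>2\<close>; \<open>1\<close> and \<open>(2 * s) powr (2 * s)\<close>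
    bound \<open>exp (- y)\<close> and \<open>y powr (2 * s) * exp (- y)\<close>.\<close>
  define D where "D = 2 * (1 + (2 * s) powr (2 * s))"
  define R where "R = r powr s"
  have "1 < R" using assms by (simp add: R_def)
  have "0 < D" by (simp add: D_def add_pos_nonneg)
  have key: "y powr s * exp (- y) \<le> D * (y powr s / (1 + y powr s)\<^sup>2)" if "0 < y" for y
  proof -
    have "(1 + y powr s)\<^sup>2 \<le> 2 * (1 + y powr (2 * s))"
      using sum_squares_bound[of 1 "y powr s"]
      by (simp add: power2_eq_square algebra_simps powr_add[symmetric])
    then have "(1 + y powr s)\<^sup>2 * exp (- y) \<le> 2 * (1 + y powr (2 * s)) * exp (- y)"
      by (rule mult_right_mono) simp
    also have "\<dots> = 2 * (exp (- y) + y powr (2 * s) * exp (- y))"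
      by (simp add: algebra_simps)
    also have "\<dots> \<le> D"
      using powr_mult_exp_minus_le[of "2 * s" y] assms that
      unfolding D_def by (intro mult_left_mono add_mono) auto
    finally have "exp (- y) \<le> D / (1 + y powr s)\<^sup>2"
      using that add_pos_nonneg[of 1 "y powr s"]
      by (subst pos_le_divide_eq) (auto simp: mult.commute)
    then have "y powr s * exp (- y) \<le> y powr s * (D / (1 + y powr s)\<^sup>2)"
      by (rule mult_left_mono) simp
    then show ?thesis by (simp add: mult.commute)
  qed
  \<comment> \<open>The factor \<open>b powr - s\<close> undoes the replacement of
    \<open>z n * x\<close> by \<open>b * x * z n\<close>.\<close>
  have "(\<Sum>n<N. (z n * x) powr s * exp (- (b * z n * x))) \<le> b powr - s * (D * (R / (R - 1)))"
    if z: "lacunary r z" and x: "0 < x" for z x N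
  proof -
    have pos: "0 < z n" for n using lacunary_pos[OF z] .
    have "lacunary R (\<lambda>n. (b * x) powr s * z n powr s)"
      unfolding R_def using assms x z by (intro lacunary_powr) auto
    then have lac: "lacunary R (\<lambda>n. (b * x * z n) powr s)"
      using pos assms x by (simp add: powr_mult less_imp_le)
    have "(\<Sum>n<N. (z n * x) powr s * exp (- (b * z n * x)))
      = b powr - s * (\<Sum>n<N. (b * x * z n) powr s * exp (- (b * x * z n)))"
      using pos assms x
      by (simp add: sum_distrib_left powr_mult less_imp_le powr_minus field_simps)
    also have "\<dots> \<le> b powr - s * (\<Sum>n<N. D * ((b * x * z n) powr s / (1 + (b * x * z n) powr s)\<^sup>2))"
      using pos assms x by (intro mult_left_mono sum_mono key) auto
    also have "\<dots> \<le> b powr - s * (D * (R / (R - 1)))"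
      using lacunary_sum_frac_le[OF lac \<open>1 < R\<close>, of N] \<open>0 < D\<close>
      unfolding sum_distrib_left[symmetric] by (intro mult_left_mono) auto
    finally show ?thesis .
  qed
  moreover have "0 < b powr - s * (D * (R / (R - 1)))"
    using assms \<open>0 < D\<close> \<open>1 < R\<close> by simp
  ultimately show ?thesis by blast
qed

section \<open>A kernel with prescribed Laplace transform\<close>

abbreviation lborel_pos :: "real measure" where
  "lborel_pos \<equiv> restrict_space lborel {0<..}"

text \<open>The Gamma integral, read off from the moments of the exponential distribution:
  \<open>erlang_density 0 c\<close> is \<open>c * exp (- (c * x))\<close> for
  \<open>x \<ge> 0\<close>, hence the division by \<open>c\<close>. The two integrands can differ
  only at \<open>0\<close>, a null set.\<close>

lemma has_bochner_integral_power_exp_pos: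
  fixes c :: real
  assumes "0 < c"
  shows "has_bochner_integral lborel_pos (\<lambda>x. x ^ j * exp (- (c * x))) (fact j / c ^ Suc j)"
proof -
  have "has_bochner_integral lborel (\<lambda>x. erlang_density 0 c x * x ^ j / c) (fact j / c ^ j / c)"
    using nn_integral_erlang_ith_moment[OF assms, of 0 j] assms
    by (intro has_bochner_integral_divide has_bochner_integral_nn_integral)
      (auto simp: erlang_density_def)
  then have "has_bochner_integral lborel (\<lambda>x. indicator {0<..} x *\<^sub>R (x ^ j * exp (- (c * x)))) (fact j / c ^ Suc j)"
    unfolding power_Suc2 divide_divide_eq_left[symmetric]
  proof (rule has_bochner_integral_cong_AE[THEN iffD1, rotated -1])
    show "AE x in lborel. erlang_density 0 c x * x ^ j / c = indicator {0<..} x *\<^sub>R (x ^ j * exp (- (c * x)))"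
      by (rule AE_mp[OF AE_lborel_singleton[of 0] AE_I2])
        (use assms in \<open>auto simp: erlang_density_def indicator_def\<close>)
  qed (auto simp: mult.commute)
  then show ?thesis
    by (simp add: has_bochner_integral_iff integrable_restrict_space integral_restrict_space)
qed

lemma integrable_exp_bound:
  fixes h :: "real \<Rightarrow> 'b :: {banach, second_countable_topology}"
  assumes "h \<in> borel_measurable borel" "0 < c" "\<And>x. 0 < x \<Longrightarrow> norm (h x) \<le> A * exp (- (c * x))"
  shows "integrable lborel_pos h"
proof (rule Bochner_Integration.integrable_bound)
  show "integrable lborel_pos (\<lambda>x. A * exp (- (c * x)))"
    using has_bochner_integral_power_exp_pos[OF assms(2), of 0]
    by (auto simp: has_bochner_integral_iff)
  show "h \<in> borel_measurable lborel_pos"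
    using assms(1) by (intro measurable_restrict_space1) simp
  show "AE x in lborel_pos. norm (h x) \<le> norm (A * exp (- (c * x)))"
    by (rule AE_I2) (use assms(3) in \<open>fastforce simp: space_restrict_space\<close>)
qed

text \<open>Half of the exponent absorbs a power of \<open>y\<close>, so that the other half of
  \<open>exp (- y)\<close> remains as decay. At \<open>n = 0\<close> the right side is
  \<open>1\<close>, because \<open>0 ^ 0 = 1\<close>.\<close>

lemma power_mult_exp_half_le:
  fixes y :: real
  assumes "0 \<le> y"
  shows "y ^ n * exp (- (y / 2)) \<le> 2 ^ n * real n ^ n"
proof (cases "n = 0 \<or> y = 0")
  case False
  then have "(y / 2) ^ n * exp (- (y / 2)) \<le> real n ^ n"
    using powr_mult_exp_minus_le[of "real n" "y / 2"] assms by (simp add: powr_realpow)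
  then show ?thesis
    by (simp add: power_divide field_simps)
qed (use assms in \<open>auto simp: power_0_left\<close>)

text \<open>\<open>k\<close> is the inverse Laplace transform of \<open>(4 * s / (1 + s)\<^sup>2) ^ N\<close>, read off from the
  binomial expansion of \<open>s ^ N = ((1 + s) - 1) ^ N\<close>.\<close>

lemma exists_kernel:
  fixes N :: nat
  assumes "2 \<le> N"
  obtains k :: "real \<Rightarrow> real" and C where
    "k \<in> borel_measurable borel" "0 < C"
    "\<And>y. 0 \<le> y \<Longrightarrow> \<bar>k y\<bar> \<le> C * y * exp (- (y / 2))"
    "\<And>A B. 0 < A \<Longrightarrow> 0 < B \<Longrightarrow>
      has_bochner_integral lborel_pos (\<lambda>x. exp (- (A * x)) * (B * k (B * x))) ((4 * A * B / (A + B)\<^sup>2) ^ N)"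
proof
  \<comment> \<open>Divided by \<open>(1 + s) ^ (2 * N)\<close>, the binomial expansion has terms in
    \<open>(1 + s) ^ i / (1 + s) ^ (2 * N)\<close>, which up to a factorial is the transform of
    \<open>y ^ (2 * N - 1 - i) * exp (- y)\<close>. \<open>Suc (j i)\<close> is this exponent;
    \<open>2 \<le> N\<close> makes it at least \<open>1\<close>, so \<open>k\<close> contains the
    factor \<open>y\<close> of the bound.\<close>
  define j where "j i = 2 * N - 2 - i" for i
  define c :: "nat \<Rightarrow> real" where "c i = 4 ^ N * (N choose i) * (-1) ^ (N - i) / fact (Suc (j i))" for i
  define k where "k y = (\<Sum>i\<le>N. c i * y ^ Suc (j i) * exp (- y))" for y
  define D where "D i = (2::real) ^ j i * real (j i) ^ j i" for i
  define C where "C = 1 + (\<Sum>i\<le>N. \<bar>c i\<bar> * D i)"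
  have D: "0 \<le> D i" for i by (simp add: D_def)
  show "k \<in> borel_measurable borel"
    unfolding k_def by measurable
  show "0 < C"
    unfolding C_def using D by (intro add_pos_nonneg sum_nonneg) auto
  show "\<bar>k y\<bar> \<le> C * y * exp (- (y / 2))" if "0 \<le> y" for y
  proof -
    have "\<bar>k y\<bar> \<le> (\<Sum>i\<le>N. \<bar>c i * y ^ Suc (j i) * exp (- y)\<bar>)"
      unfolding k_def by (rule sum_abs)
    also have "\<dots> \<le> (\<Sum>i\<le>N. \<bar>c i\<bar> * D i * (y * exp (- (y / 2))))"
    proof (rule sum_mono)
      fix i
      have "exp (- y) = exp (- (y / 2)) * exp (- (y / 2))"
        by (simp add: exp_add[symmetric])
      then have "\<bar>c i * y ^ Suc (j i) * exp (- y)\<bar>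
        = \<bar>c i\<bar> * (y ^ j i * exp (- (y / 2))) * (y * exp (- (y / 2)))"
        using that by (simp add: abs_mult)
      also have "\<dots> \<le> \<bar>c i\<bar> * D i * (y * exp (- (y / 2)))"
        using that power_mult_exp_half_le[OF that, of "j i"]
        by (intro mult_right_mono mult_left_mono) (auto simp: D_def)
      finally show "\<bar>c i * y ^ Suc (j i) * exp (- y)\<bar> \<le> \<bar>c i\<bar> * D i * (y * exp (- (y / 2)))" .
    qed
    also have "\<dots> \<le> C * (y * exp (- (y / 2)))"
      using that by (simp add: C_def sum_distrib_right distrib_right)
    finally show ?thesis by (simp add: mult.assoc)
  qed
  fix A B :: real assume AB: "0 < A" "0 < B"
  \<comment> \<open>Dilating the kernel by \<open>B\<close> evaluates its transform at
    \<open>s = A / B\<close>, where \<open>4 * s / (1 + s)\<^sup>2\<close> equals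
    \<open>4 * A * B / (A + B)\<^sup>2\<close>.\<close>
  have "has_bochner_integral lborel_pos
      (\<lambda>x. \<Sum>i\<le>N. c i * B ^ Suc (Suc (j i)) * (x ^ Suc (j i) * exp (- ((A + B) * x))))
      (\<Sum>i\<le>N. c i * B ^ Suc (Suc (j i)) * (fact (Suc (j i)) / (A + B) ^ Suc (Suc (j i))))"
    using AB by (intro has_bochner_integral_sum has_bochner_integral_mult_right
        has_bochner_integral_power_exp_pos) auto
  also have "(\<lambda>x. \<Sum>i\<le>N. c i * B ^ Suc (Suc (j i)) * (x ^ Suc (j i) * exp (- ((A + B) * x))))
    = (\<lambda>x. exp (- (A * x)) * (B * k (B * x)))"
  proof
    fix x
    have "exp (- ((A + B) * x)) = exp (- (A * x)) * exp (- (B * x))"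
      by (simp add: exp_add[symmetric] distrib_right)
    then show "(\<Sum>i\<le>N. c i * B ^ Suc (Suc (j i)) * (x ^ Suc (j i) * exp (- ((A + B) * x))))
      = exp (- (A * x)) * (B * k (B * x))"
      by (simp add: k_def sum_distrib_left power_mult_distrib mult_ac)
  qed
  also have "(\<Sum>i\<le>N. c i * B ^ Suc (Suc (j i)) * (fact (Suc (j i)) / (A + B) ^ Suc (Suc (j i))))
    = (\<Sum>i\<le>N. (4 * B / (A + B)\<^sup>2) ^ N * ((N choose i) * (A + B) ^ i * (- B) ^ (N - i)))"
  proof (rule sum.cong[OF refl])
    fix i assume "i \<in> {..N}"
    then have i: "i \<le> N" and e: "Suc (Suc (j i)) = N + (N - i)" "N + (N - i) + i = 2 * N"
      using assms by (auto simp: j_def)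
    have "(A + B) ^ (N + (N - i)) * (A + B) ^ i = ((A + B)\<^sup>2) ^ N"
      by (simp only: power_add[symmetric] e power_mult)
    then have "1 / (A + B) ^ (N + (N - i)) = (A + B) ^ i / ((A + B)\<^sup>2) ^ N"
      using AB by (simp add: field_simps)
    moreover have "c i * B ^ Suc (Suc (j i)) * (fact (Suc (j i)) / (A + B) ^ Suc (Suc (j i)))
      = 4 ^ N * (N choose i) * (-1) ^ (N - i) * B ^ (N + (N - i)) * (1 / (A + B) ^ (N + (N - i)))"
      unfolding e(1) c_def by (simp del: fact_Suc)
    moreover have "(- B) ^ (N - i) = (-1) ^ (N - i) * B ^ (N - i)"
      by (simp add: power_mult_distrib[symmetric])
    ultimately show "c i * B ^ Suc (Suc (j i)) * (fact (Suc (j i)) / (A + B) ^ Suc (Suc (j i)))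
      = (4 * B / (A + B)\<^sup>2) ^ N * ((N choose i) * (A + B) ^ i * (- B) ^ (N - i))"
      by (simp add: power_add power_divide power_mult_distrib ac_simps)
  qed
  \<comment> \<open>The binomial theorem backwards; the last bracket collapses to
    \<open>A ^ N\<close>.\<close>
  also have "\<dots> = (4 * B / (A + B)\<^sup>2) ^ N * ((A + B) + - B) ^ N"
    by (simp only: binomial_ring sum_distrib_left)
  also have "\<dots> = (4 * A * B / (A + B)\<^sup>2) ^ N"
    by (simp add: power_mult_distrib[symmetric] ac_simps)
  finally show "has_bochner_integral lborel_pos (\<lambda>x. exp (- (A * x)) * (B * k (B * x))) ((4 * A * B / (A + B)\<^sup>2) ^ N)" .
qed

section \<open>Diagonal dominance of the pairing matrix\<close>

text \<open>With \<open>t = b / a\<close> the left side is \<open>4 * t / (1 + t)\<^sup>2\<close>,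
  which decreases for \<open>t \<ge> 1\<close>. After clearing denominators the difference factors
  as \<open>(b - r * a) * (r * b - a)\<close>.\<close>

lemma four_mult_div_square_le:
  fixes a b r :: real
  assumes "0 < a" "1 < r" "r * a \<le> b"
  shows "4 * a * b / (a + b)\<^sup>2 \<le> 4 * r / (1 + r)\<^sup>2"
proof -
  have "1 * a \<le> r * a" using assms by (intro mult_right_mono) auto
  then have "a \<le> b" "0 < b" using assms by linarith+
  then have "1 * a \<le> r * b" using assms by (intro mult_mono) auto
  then have "0 \<le> (b - r * a) * (r * b - a)"
    using assms by (intro mult_nonneg_nonneg) auto
  also have "\<dots> = r * (a + b)\<^sup>2 - a * b * (1 + r)\<^sup>2"
    by (simp add: power2_eq_square algebra_simps)
  finally show ?thesis
    using assms \<open>0 < b\<close> by (simp add: divide_simps)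
qed

text \<open>For the column sums: one factor of a matrix entry turns the weight
  \<open>1 / z m\<close> into a multiple of \<open>1 / z n\<close>.\<close>

lemma four_mult_div_square_divide_le:
  fixes a b :: real
  assumes "0 < a" "0 < b"
  shows "4 * a * b / (a + b)\<^sup>2 / b \<le> 4 / a"
proof -
  have "4 * a * b / (a + b)\<^sup>2 / b = 4 * a / (a + b)\<^sup>2"
    using assms by simp
  also have "\<dots> \<le> 4 * a / (a * a)"
    using assms by (intro divide_left_mono mult_pos_pos) (auto simp: power2_eq_square algebra_simps add_pos_pos)
  finally show ?thesis
    using assms by simp
qed

text \<open>The diagonal entries are \<open>1\<close>. Off the diagonal, the row sums and the column
  sums weighted by \<open>1 / z m\<close> are at most \<open>1 / 2\<close> for large
  \<open>N\<close>, so by Schur's test that part is a contraction by \<open>1 / 2\<close> in the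
  weighted sequence norm and can be absorbed.\<close>

lemma diagonal_dominance:
  assumes r: "1 < r" and q: "1 \<le> q"
  shows "\<exists>N\<ge>2. \<forall>z (a :: nat \<Rightarrow> complex) L. lacunary r z \<longrightarrow>
    (\<Sum>n<L. norm (a n) powr q / z n)
      \<le> 2 powr q * (\<Sum>m<L. norm (\<Sum>n<L. a n * of_real ((4 * z n * z m / (z n + z m)\<^sup>2) ^ N)) powr q / z m)"
proof -
  define \<theta> where "\<theta> = 4 * r / (1 + r)\<^sup>2"
  have "0 < (r - 1)\<^sup>2" using r by simp
  then have "4 * r < (1 + r)\<^sup>2" by (simp add: power2_eq_square algebra_simps)
  then have \<theta>: "0 < \<theta>" "\<theta> < 1" using r by (auto simp: \<theta>_def divide_less_eq)
  have pos: "0 < (r - 1) / (32 * r)" using r by simp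
  \<comment> \<open>The threshold is set for \<open>\<theta>K\<close>: one
    \<open>4 * (r / (r - 1))\<close> comes from \<open>\<phi>_sum\<close>, the other
    \<open>4\<close> bounds the second spare factor of an entry.\<close>
  obtain K where K: "\<theta> ^ K < (r - 1) / (32 * r)"
    using real_arch_pow_inv[OF pos \<theta>(2)] by blast
  \<comment> \<open>\<open>K\<close> factors of an entry supply the smallness
    \<open>\<theta> ^ K\<close>. Of the two others, one is summed by \<open>\<phi>_sum\<close>; the
    second is bounded by a constant in the rows and exchanges the weights in the columns.\<close>
  define N where "N = K + 2"
  have \<theta>K: "\<theta> ^ K * (4 * (4 * (r / (r - 1)))) \<le> 1 / 2"
    using K r by (simp add: field_simps)
  have "(\<Sum>n<L. norm (a n) powr q / z n)
      \<le> 2 powr q * (\<Sum>m<L. norm (\<Sum>n<L. a n * of_real ((4 * z n * z m / (z n + z m)\<^sup>2) ^ N)) powr q / z m)"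
    if z: "lacunary r z" for z and a :: "nat \<Rightarrow> complex" and L
  proof -
    have zp: "0 < z n" for n using lacunary_pos[OF z] .
    define \<phi> where "\<phi> m n = 4 * z n * z m / (z n + z m)\<^sup>2" for m n
    have \<phi>_sym: "\<phi> m n = \<phi> n m" for m n by (simp add: \<phi>_def ac_simps)
    have \<phi>_pos: "0 < \<phi> m n" for m n
      using zp[of m] zp[of n] by (simp add: \<phi>_def add_pos_pos)
    have \<phi>_diag: "\<phi> m m = 1" for m
      using zp[of m] by (simp add: \<phi>_def power2_eq_square)
    have \<phi>_le: "\<phi> m n \<le> \<theta>" if "m \<noteq> n" for m n
    proof -
      have *: "\<phi> m n \<le> \<theta>" if "n < m" for m n
        unfolding \<phi>_def \<theta>_def
        by (rule four_mult_div_square_le[OF zp r lacunary_less[OF z r that]])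
      show ?thesis
        using *[of m n] *[of n m] \<open>m \<noteq> n\<close> \<phi>_sym[of m n] by (cases m n rule: linorder_cases) auto
    qed
    have \<phi>_sum: "(\<Sum>n\<in>{..<L} - {m}. \<phi> m n) \<le> 4 * (r / (r - 1))" for m
    proof -
      have "(\<Sum>n\<in>{..<L} - {m}. \<phi> m n) \<le> (\<Sum>n<L. \<phi> m n)"
        using \<phi>_pos by (intro sum_mono2) (auto simp: less_imp_le)
      also have "\<dots> = 4 * (\<Sum>n<L. (1 / z m * z n) / (1 + 1 / z m * z n)\<^sup>2)"
      proof -
        have "\<phi> m n = 4 * ((1 / z m * z n) / (1 + 1 / z m * z n)\<^sup>2)" for n
        proof -
          have "1 + 1 / z m * z n = (z n + z m) / z m"
            using zp[of m] by (simp add: field_simps)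
          then show ?thesis
            using zp[of m] zp[of n] by (simp add: \<phi>_def power_divide power2_eq_square)
        qed
        then show ?thesis by (simp add: sum_distrib_left)
      qed
      also have "\<dots> \<le> 4 * (r / (r - 1))"
        using lacunary_sum_frac_le[OF lacunary_mult[OF z] r, of "1 / z m" L] zp[of m] by simp
      finally show ?thesis .
    qed
    have T_le: "\<phi> m n ^ N \<le> \<theta> ^ K * \<phi> m n * \<phi> m n" if "m \<noteq> n" for m n
    proof -
      have "\<phi> m n ^ N = \<phi> m n ^ K * (\<phi> m n * \<phi> m n)"
        by (simp add: N_def power_add power2_eq_square)
      also have "\<dots> \<le> \<theta> ^ K * (\<phi> m n * \<phi> m n)"
        using \<phi>_le[OF that] \<phi>_pos[of m n] by (intro mult_right_mono power_mono) auto
      finally show ?thesis by (simp add: mult.assoc)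
    qed
    have row: "(\<Sum>n\<in>{..<L} - {m}. \<phi> m n ^ N) \<le> 1 / 2" for m
    proof -
      have "(\<Sum>n\<in>{..<L} - {m}. \<phi> m n ^ N) \<le> (\<Sum>n\<in>{..<L} - {m}. \<theta> ^ K * \<phi> m n * 4)"
      proof (rule sum_mono)
        fix n assume n: "n \<in> {..<L} - {m}"
        \<comment> \<open>A crude bound, chosen so that rows and columns lead to the same constant
          \<open>\<theta>K\<close>.\<close>
        have "\<phi> m n \<le> 4" using \<phi>_le[of m n] n \<theta> by auto
        then have "\<theta> ^ K * \<phi> m n * \<phi> m n \<le> \<theta> ^ K * \<phi> m n * 4"
          using \<phi>_pos[of m n] \<theta> by (intro mult_left_mono) auto
        then show "\<phi> m n ^ N \<le> \<theta> ^ K * \<phi> m n * 4"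
          using T_le[of m n] n by auto
      qed
      also have "\<dots> = \<theta> ^ K * 4 * (\<Sum>n\<in>{..<L} - {m}. \<phi> m n)"
        by (simp add: sum_distrib_left ac_simps)
      also have "\<dots> \<le> \<theta> ^ K * 4 * (4 * (r / (r - 1)))"
        using \<phi>_sum[of m] \<theta> by (intro mult_left_mono) auto
      also have "\<dots> = \<theta> ^ K * (4 * (4 * (r / (r - 1))))" by simp
      also have "\<dots> \<le> 1 / 2" by (rule \<theta>K)
      finally show ?thesis .
    qed
    have col: "(\<Sum>m\<in>{..<L} - {n}. \<phi> m n ^ N / z m) \<le> 1 / 2 / z n" for n
    proof -
      have "(\<Sum>m\<in>{..<L} - {n}. \<phi> m n ^ N / z m) \<le> (\<Sum>m\<in>{..<L} - {n}. \<theta> ^ K * \<phi> n m * (4 / z n))"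
      proof (rule sum_mono)
        fix m assume m: "m \<in> {..<L} - {n}"
        have "\<phi> m n ^ N / z m \<le> \<theta> ^ K * \<phi> m n * \<phi> m n / z m"
          using T_le[of m n] m zp[of m] by (intro divide_right_mono) (auto simp: less_imp_le)
        also have "\<dots> = \<theta> ^ K * \<phi> m n * (\<phi> m n / z m)" by simp
        also have "\<dots> \<le> \<theta> ^ K * \<phi> m n * (4 / z n)"
        proof (rule mult_left_mono)
          show "\<phi> m n / z m \<le> 4 / z n"
            unfolding \<phi>_def by (rule four_mult_div_square_divide_le[OF zp zp])
        qed (use \<phi>_pos[of m n] \<theta> in auto)
        finally show "\<phi> m n ^ N / z m \<le> \<theta> ^ K * \<phi> n m * (4 / z n)"
          by (simp add: \<phi>_sym)
      qed
      also have "\<dots> = \<theta> ^ K * 4 / z n * (\<Sum>m\<in>{..<L} - {n}. \<phi> n m)"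
        by (simp add: sum_distrib_left sum_divide_distrib ac_simps)
      also have "\<dots> \<le> \<theta> ^ K * 4 / z n * (4 * (r / (r - 1)))"
        using \<phi>_sum[of n] \<theta> zp[of n] by (intro mult_left_mono) auto
      also have "\<dots> = \<theta> ^ K * (4 * (4 * (r / (r - 1)))) / z n" by (simp add: ac_simps)
      also have "\<dots> \<le> 1 / 2 / z n"
        using \<theta>K zp[of n] by (intro divide_right_mono) auto
      finally show ?thesis .
    qed
    define X where "X = (\<Sum>n<L. norm (a n) powr q / z n)"
    define b where "b m = (\<Sum>n<L. a n * of_real (\<phi> m n ^ N))" for m
    define e where "e m = (\<Sum>n\<in>{..<L} - {m}. \<phi> m n ^ N * norm (a n))" for m
    have e_powr: "e m powr q \<le> (1 / 2) powr (q - 1) * (\<Sum>n\<in>{..<L} - {m}. \<phi> m n ^ N * norm (a n) powr q)" for m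
    proof -
      have "e m powr q \<le> (\<Sum>n\<in>{..<L} - {m}. \<phi> m n ^ N) powr (q - 1) * (\<Sum>n\<in>{..<L} - {m}. \<phi> m n ^ N * norm (a n) powr q)"
        unfolding e_def using q \<phi>_pos by (intro sum_mult_powr_le) (auto simp: less_imp_le)
      also have "\<dots> \<le> (1 / 2) powr (q - 1) * (\<Sum>n\<in>{..<L} - {m}. \<phi> m n ^ N * norm (a n) powr q)"
        using row[of m] q \<phi>_pos
        by (intro mult_right_mono powr_mono2 sum_nonneg) (auto simp: less_imp_le)
      finally show ?thesis .
    qed
    \<comment> \<open>Schur's test: Jensen's inequality on the rows has contributed
      \<open>(1 / 2) powr (q - 1)\<close>; after the sums are exchanged, the weighted columns
      contribute the remaining factor \<open>1 / 2\<close>.\<close>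
    have "(\<Sum>m<L. e m powr q / z m)
      \<le> (\<Sum>m<L. (1 / 2) powr (q - 1) * (\<Sum>n\<in>{..<L} - {m}. \<phi> m n ^ N * norm (a n) powr q) / z m)"
      using e_powr zp by (intro sum_mono divide_right_mono) (auto simp: less_imp_le)
    also have "\<dots> = (1 / 2) powr (q - 1) * (\<Sum>m<L. \<Sum>n\<in>{..<L} - {m}. \<phi> m n ^ N / z m * norm (a n) powr q)"
      by (simp add: sum_distrib_left sum_divide_distrib ac_simps)
    also have "(\<Sum>m<L. \<Sum>n\<in>{..<L} - {m}. \<phi> m n ^ N / z m * norm (a n) powr q)
      = (\<Sum>n<L. \<Sum>m\<in>{..<L} - {n}. \<phi> m n ^ N / z m * norm (a n) powr q)"
      by (subst (1 2) sum.Sigma) (auto intro!: sum.reindex_bij_witness[of _ "\<lambda>(n, m). (m, n)" "\<lambda>(n, m). (m, n)"])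
    also have "\<dots> = (\<Sum>n<L. norm (a n) powr q * (\<Sum>m\<in>{..<L} - {n}. \<phi> m n ^ N / z m))"
      by (simp add: sum_distrib_left ac_simps)
    also have "(1 / 2) powr (q - 1) * \<dots> \<le> (1 / 2) powr (q - 1) * (\<Sum>n<L. norm (a n) powr q * (1 / 2 / z n))"
      by (intro mult_left_mono sum_mono col) auto
    also have "\<dots> = (1 / 2) powr q * X"
      by (simp add: X_def sum_distrib_left powr_diff ac_simps)
    finally have E: "(\<Sum>m<L. e m powr q / z m) \<le> (1 / 2) powr q * X" .
    have "X \<le> (\<Sum>m<L. 2 powr (q - 1) * (norm (b m) powr q + e m powr q) / z m)"
      unfolding X_def
    proof (rule sum_mono)
      fix m assume m: "m \<in> {..<L}"
      have "b m = a m + (\<Sum>n\<in>{..<L} - {m}. a n * of_real (\<phi> m n ^ N))"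
        unfolding b_def using m by (subst sum.remove[of _ m]) (auto simp: \<phi>_diag)
      then have "norm (a m) = norm (b m - (\<Sum>n\<in>{..<L} - {m}. a n * of_real (\<phi> m n ^ N)))"
        by simp
      also have "\<dots> \<le> norm (b m) + norm (\<Sum>n\<in>{..<L} - {m}. a n * of_real (\<phi> m n ^ N))"
        by (rule norm_triangle_ineq4)
      also have "norm (\<Sum>n\<in>{..<L} - {m}. a n * of_real (\<phi> m n ^ N)) \<le> e m"
        unfolding e_def using \<phi>_pos
        by (intro sum_norm_le) (auto simp: norm_mult norm_power less_imp_le mult.commute)
      finally have "norm (a m) \<le> norm (b m) + e m" by simp
      then have "norm (a m) powr q \<le> (norm (b m) + e m) powr q"
        using q by (intro powr_mono2) auto
      also have "\<dots> \<le> 2 powr (q - 1) * (norm (b m) powr q + e m powr q)"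
        using q \<phi>_pos by (intro add_powr_le) (auto simp: e_def less_imp_le intro!: sum_nonneg)
      finally show "norm (a m) powr q / z m \<le> 2 powr (q - 1) * (norm (b m) powr q + e m powr q) / z m"
        using zp[of m] by (intro divide_right_mono) auto
    qed
    also have "\<dots> = 2 powr (q - 1) * (\<Sum>m<L. norm (b m) powr q / z m) + 2 powr (q - 1) * (\<Sum>m<L. e m powr q / z m)"
      by (simp add: sum_distrib_left sum.distrib[symmetric] add_divide_distrib distrib_left)
    also have "\<dots> \<le> 2 powr (q - 1) * (\<Sum>m<L. norm (b m) powr q / z m) + 2 powr (q - 1) * ((1 / 2) powr q * X)"
      using E by (intro add_left_mono mult_left_mono) auto
    \<comment> \<open>The off-diagonal part costs at most half of the finite quantity
      \<open>X\<close> and is moved to the left side.\<close>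
    also have "2 powr (q - 1) * ((1 / 2) powr q * X) = X / 2"
      by (simp add: powr_diff powr_divide)
    finally have "X \<le> 2 * 2 powr (q - 1) * (\<Sum>m<L. norm (b m) powr q / z m)" by simp
    then show ?thesis
      by (simp add: X_def b_def \<phi>_def powr_diff)
  qed
  then show ?thesis
    by (intro exI[of _ N]) (auto simp: N_def)
qed

section \<open>Lower bound for lacunary exponential sums\<close>

lemma powr_mult_exp_minus_scaled_le:
  fixes x s b :: real
  assumes "0 < s" "0 < b" "0 \<le> x"
  shows "x powr s * exp (- (b * x)) \<le> (s / b) powr s"
proof -
  have "x powr s * exp (- (b * x)) = (b * x) powr s * exp (- (b * x)) / b powr s"
    using assms by (simp add: powr_mult)
  also have "\<dots> \<le> s powr s / b powr s"
    using assms by (intro divide_right_mono powr_mult_exp_minus_le) auto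
  finally show ?thesis
    using assms by (simp add: powr_divide)
qed

text \<open>Weighting by \<open>x\<close> before applying Jensen's inequality leaves \<open>(z m * x) powr q\<close> inside the
  integral; without this factor the sum over \<open>m\<close> would not be bounded as \<open>x\<close> tends to \<open>0\<close>.\<close>

lemma kernel_pairing_bound:
  assumes r: "1 < r" and q: "1 \<le> q"
    and k[measurable]: "k \<in> borel_measurable borel" and C0: "0 < C0"
    and kb: "\<And>y. 0 \<le> y \<Longrightarrow> \<bar>k y\<bar> \<le> C0 * y * exp (- (y / 2))"
  obtains C where "0 < C"
    "\<And>z L (G :: real \<Rightarrow> complex) A c. lacunary r z \<Longrightarrow> G \<in> borel_measurable borel \<Longrightarrow> 0 < c \<Longrightarrow>
      (\<forall>x>0. norm (G x) \<le> A * exp (- (c * x))) \<Longrightarrow>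
      (\<Sum>m<L. norm (\<integral>x. G x * of_real (z m * k (z m * x)) \<partial>lborel_pos) powr q / z m)
        \<le> C * (\<integral>x. norm (G x) powr q \<partial>lborel_pos)"
proof -
  have "0 < q" using q by simp
  obtain D where D: "0 < D" "\<And>z x N. lacunary r z \<Longrightarrow> 0 < x \<Longrightarrow>
      (\<Sum>n<N. (z n * x) powr q * exp (- (1 / 2 * z n * x))) \<le> D"
    using lacunary_sum_powr_exp_le[OF r \<open>0 < q\<close>, of "1 / 2"] by auto
  define K where "K = C0 powr q * 2 powr (q - 1)"
  have "0 < K" using C0 by (simp add: K_def)
  have main: "(\<Sum>m<L. norm (\<integral>x. G x * of_real (z m * k (z m * x)) \<partial>lborel_pos) powr q / z m)
      \<le> K * D * (\<integral>x. norm (G x) powr q \<partial>lborel_pos)"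
    if z: "lacunary r z" and G[measurable]: "G \<in> borel_measurable borel" and c: "0 < c"
      and "\<forall>x>0. norm (G x) \<le> A * exp (- (c * x))" for z L and G :: "real \<Rightarrow> complex" and A c
  proof -
    have Gb: "norm (G x) \<le> A * exp (- (c * x))" if "0 < x" for x
      using that \<open>\<forall>x>0. norm (G x) \<le> A * exp (- (c * x))\<close> by blast
    have zp: "0 < z n" for n using lacunary_pos[OF z] .
    have "0 \<le> A * exp (- (c * 1))"
      using Gb[of 1] norm_ge_zero[of "G 1"] by (metis order_trans zero_less_one)
    then have A: "0 \<le> A" by (simp add: zero_le_mult_iff)
    have Gq: "norm (G x) powr q \<le> A powr q * exp (- (c * q * x))" if "0 < x" for x
    proof -
      have "norm (G x) powr q \<le> (A * exp (- (c * x))) powr q"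
        using Gb[OF that] q by (intro powr_mono2) auto
      then show ?thesis using A by (simp add: powr_mult exp_powr_real mult_ac)
    qed
    have intGq: "integrable lborel_pos (\<lambda>x. norm (G x) powr q)"
      using Gq c q by (intro integrable_exp_bound[of _ "c * q" "A powr q"]) auto
    have xexp: "x * exp (- (b * x)) \<le> 1 / b" if "0 < x" "0 < b" for x b :: real
      using powr_mult_exp_minus_scaled_le[of 1 b x] that by simp
    have int_term: "integrable lborel_pos (\<lambda>x. (\<mu> * x) powr q * exp (- (1 / 2 * \<mu> * x)) * norm (G x) powr q)"
      if "0 < \<mu>" for \<mu>
    proof (rule integrable_exp_bound[of _ "c * q" "(2 * q) powr q * A powr q"])
      fix x :: real assume x: "0 < x"
      have "(\<mu> * x) powr q * exp (- (1 / 2 * (\<mu> * x))) \<le> (q / (1 / 2)) powr q"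
        using x that q by (intro powr_mult_exp_minus_scaled_le) auto
      then have "(\<mu> * x) powr q * exp (- (1 / 2 * \<mu> * x)) \<le> (2 * q) powr q"
        by (simp add: mult.commute mult.assoc)
      then show "norm ((\<mu> * x) powr q * exp (- (1 / 2 * \<mu> * x)) * norm (G x) powr q)
        \<le> (2 * q) powr q * A powr q * exp (- (c * q * x))"
        using mult_mono[OF _ Gq[OF x], of "(\<mu> * x) powr q * exp (- (1 / 2 * \<mu> * x))" "(2 * q) powr q"]
        by (simp add: mult.assoc)
    qed (use c q in auto)
    have one: "norm (\<integral>x. G x * of_real (\<mu> * k (\<mu> * x)) \<partial>lborel_pos) powr q / \<mu>
      \<le> K * (\<integral>x. (\<mu> * x) powr q * exp (- (1 / 2 * \<mu> * x)) * norm (G x) powr q \<partial>lborel_pos)"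
      if \<mu>: "0 < \<mu>" for \<mu>
    proof -
      \<comment> \<open>\<open>w\<close> is the decay of the dilated kernel and has mass
        \<open>2 / \<mu>\<close>; \<open>u\<close> takes over the factor \<open>x\<close> from the
        bound on \<open>k\<close>. Jensen's inequality is applied to this pair.\<close>
      define w where "w x = exp (- (\<mu> / 2 * x))" for x
      define u where "u x = x * norm (G x)" for x
      have wm[measurable]: "w \<in> borel_measurable borel" unfolding w_def by measurable
      have um[measurable]: "u \<in> borel_measurable borel" unfolding u_def by measurable
      have wu: "w x * u x \<le> 1 / (\<mu> / 2) * (A * exp (- (c * x)))" if "0 < x" for x
        using mult_mono[OF xexp[OF that, of "\<mu> / 2"] Gb[OF that]] \<mu> that
        by (simp add: w_def u_def mult_ac)
      have int_wu: "integrable lborel_pos (\<lambda>x. w x * u x)"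
      proof (rule integrable_exp_bound[of _ c "1 / (\<mu> / 2) * A"])
        fix x :: real assume x: "0 < x"
        then show "norm (w x * u x) \<le> 1 / (\<mu> / 2) * A * exp (- (c * x))"
          using wu[OF x] by (simp add: w_def u_def)
      qed (use c in auto)
      have w_int: "has_bochner_integral lborel_pos w (2 / \<mu>)"
        using has_bochner_integral_power_exp_pos[of "\<mu> / 2" 0] \<mu> by (simp add: w_def[abs_def])
      have wu_eq: "w x * u x powr q = \<mu> powr - q * ((\<mu> * x) powr q * exp (- (1 / 2 * \<mu> * x)) * norm (G x) powr q)"
        if "0 < x" for x
      proof -
        have 1: "\<mu> powr - q * \<mu> powr q = 1"
          using \<mu> by (simp add: powr_add[symmetric])
        have 2: "(\<mu> * x) powr q = \<mu> powr q * x powr q" "u x powr q = x powr q * norm (G x) powr q"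
          using \<mu> that by (simp_all add: u_def powr_mult)
        have 3: "w x = exp (- (1 / 2 * \<mu> * x))" by (simp add: w_def)
        have "P * (M * X * E * Y) = (P * M) * (E * (X * Y))" for P M X E Y :: real
          by simp
        then show ?thesis
          unfolding 2 3 using 1 by simp
      qed
      have int_wuq: "integrable lborel_pos (\<lambda>x. w x * u x powr q)"
      proof -
        have "integrable lborel_pos (\<lambda>x. w x * u x powr q) \<longleftrightarrow> integrable lborel_pos
          (\<lambda>x. \<mu> powr - q * ((\<mu> * x) powr q * exp (- (1 / 2 * \<mu> * x)) * norm (G x) powr q))"
          by (rule Bochner_Integration.integrable_cong[OF refl], rule wu_eq) (simp add: space_restrict_space)
        then show ?thesis
          using int_term[OF \<mu>] by simp
      qed
      have kx: "norm (G x * of_real (\<mu> * k (\<mu> * x))) \<le> C0 * \<mu>\<^sup>2 * (w x * u x)" if x: "0 < x" for x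
      proof -
        have "norm (G x * of_real (\<mu> * k (\<mu> * x))) = norm (G x) * \<mu> * \<bar>k (\<mu> * x)\<bar>"
          using \<mu> by (simp add: norm_mult abs_mult)
        also have "\<dots> \<le> norm (G x) * \<mu> * (C0 * (\<mu> * x) * exp (- ((\<mu> * x) / 2)))"
          using \<mu> x by (intro mult_left_mono kb) auto
        also have "\<dots> = C0 * \<mu>\<^sup>2 * (w x * u x)"
          by (simp add: w_def u_def power2_eq_square mult_ac)
        finally show ?thesis .
      qed
      have "norm (\<integral>x. G x * of_real (\<mu> * k (\<mu> * x)) \<partial>lborel_pos) \<le> (\<integral>x. C0 * \<mu>\<^sup>2 * (w x * u x) \<partial>lborel_pos)"
      proof (rule Bochner_Integration.integral_norm_bound_integral)
        show "integrable lborel_pos (\<lambda>x. G x * complex_of_real (\<mu> * k (\<mu> * x)))"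
        proof (rule integrable_exp_bound[of _ c "C0 * \<mu>\<^sup>2 * (1 / (\<mu> / 2) * A)"])
          fix x :: real assume x: "0 < x"
          show "norm (G x * of_real (\<mu> * k (\<mu> * x))) \<le> C0 * \<mu>\<^sup>2 * (1 / (\<mu> / 2) * A) * exp (- (c * x))"
            using kx[OF x] mult_left_mono[OF wu[OF x], of "C0 * \<mu>\<^sup>2"] C0 by (simp add: mult.assoc)
        qed (use c in auto)
      qed (use int_wu kx in \<open>auto simp: space_restrict_space\<close>)
      also have "\<dots> = C0 * \<mu>\<^sup>2 * (\<integral>x. w x * u x \<partial>lborel_pos)" by simp
      finally have "norm (\<integral>x. G x * of_real (\<mu> * k (\<mu> * x)) \<partial>lborel_pos) powr q
        \<le> (C0 * \<mu>\<^sup>2 * (\<integral>x. w x * u x \<partial>lborel_pos)) powr q"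
        using q by (intro powr_mono2) auto
      also have "\<dots> = C0 powr q * \<mu> powr (2 * q) * (\<integral>x. w x * u x \<partial>lborel_pos) powr q"
      proof -
        have "(\<mu>\<^sup>2) powr q = \<mu> powr (2 * q)"
          using \<mu> by (simp add: powr_powr flip: powr_numeral)
        then show ?thesis
          using C0 by (simp add: powr_mult)
      qed
      also have "(\<integral>x. w x * u x \<partial>lborel_pos) powr q
        \<le> (\<integral>x. w x \<partial>lborel_pos) powr (q - 1) * (\<integral>x. w x * u x powr q \<partial>lborel_pos)"
        using w_int int_wu int_wuq
        by (intro integral_mult_powr_le[OF q])
          (auto simp: has_bochner_integral_iff space_restrict_space u_def, simp add: w_def)
      also have "(\<integral>x. w x \<partial>lborel_pos) = 2 / \<mu>"
        using w_int by (simp add: has_bochner_integral_iff)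
      also have "(\<integral>x. w x * u x powr q \<partial>lborel_pos)
        = \<mu> powr - q * (\<integral>x. (\<mu> * x) powr q * exp (- (1 / 2 * \<mu> * x)) * norm (G x) powr q \<partial>lborel_pos)"
        (is "_ = _ * ?I")
      proof -
        have "(\<integral>x. w x * u x powr q \<partial>lborel_pos)
          = (\<integral>x. \<mu> powr - q * ((\<mu> * x) powr q * exp (- (1 / 2 * \<mu> * x)) * norm (G x) powr q) \<partial>lborel_pos)"
          by (rule Bochner_Integration.integral_cong[OF refl], rule wu_eq) (simp add: space_restrict_space)
        then show ?thesis by simp
      qed
      finally have "norm (\<integral>x. G x * of_real (\<mu> * k (\<mu> * x)) \<partial>lborel_pos) powr q / \<mu>
        \<le> C0 powr q * \<mu> powr (2 * q) * ((2 / \<mu>) powr (q - 1) * (\<mu> powr - q * ?I)) / \<mu>"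
        using \<mu> by (intro divide_right_mono) (auto simp: mult_left_mono)
      also have "\<dots> = K * (\<mu> powr (2 * q) * \<mu> powr - (q - 1) * \<mu> powr - q * \<mu> powr - 1) * ?I"
      proof -
        have 1: "(2 / \<mu>) powr (q - 1) = 2 powr (q - 1) * \<mu> powr - (q - 1)"
          using \<mu> powr_divide[of 2 \<mu> "q - 1"] powr_minus_divide[of \<mu> "q - 1"] by simp
        have 2: "\<mu> powr - 1 = 1 / \<mu>"
          using \<mu> by (simp add: powr_minus divide_inverse)
        have "a * b * ((c * d) * (e * f)) / \<mu> = a * c * (b * d * e * (1 / \<mu>)) * f" for a b c d e f
          by simp
        then show ?thesis
          unfolding K_def 1 2 .
      qed
      \<comment> \<open>The powers of \<open>\<mu>\<close> cancel: \<open>2 * q\<close> stems from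
        the factor \<open>\<mu>\<^sup>2\<close>, \<open>- (q - 1)\<close> from the mass of
        \<open>w\<close>, \<open>- q\<close> from \<open>wu_eq\<close> and \<open>- 1\<close> from
        the division by \<open>\<mu>\<close>.\<close>
      also have "\<mu> powr (2 * q) * \<mu> powr - (q - 1) * \<mu> powr - q * \<mu> powr - 1 = 1"
        using \<mu> by (simp only: powr_add[symmetric]) simp
      finally show ?thesis by simp
    qed
    have "(\<Sum>m<L. norm (\<integral>x. G x * of_real (z m * k (z m * x)) \<partial>lborel_pos) powr q / z m)
      \<le> (\<Sum>m<L. K * (\<integral>x. (z m * x) powr q * exp (- (1 / 2 * z m * x)) * norm (G x) powr q \<partial>lborel_pos))"
      by (intro sum_mono one zp)
    also have "\<dots> = K * (\<Sum>m<L. \<integral>x. (z m * x) powr q * exp (- (1 / 2 * z m * x)) * norm (G x) powr q \<partial>lborel_pos)"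
      by (simp only: sum_distrib_left)
    also have "(\<Sum>m<L. \<integral>x. (z m * x) powr q * exp (- (1 / 2 * z m * x)) * norm (G x) powr q \<partial>lborel_pos)
      = (\<integral>x. (\<Sum>m<L. (z m * x) powr q * exp (- (1 / 2 * z m * x)) * norm (G x) powr q) \<partial>lborel_pos)"
      by (subst Bochner_Integration.integral_sum) (use int_term zp in auto)
    \<comment> \<open>At each \<open>x\<close> the sum over \<open>m\<close> is at most
      \<open>D\<close>, whatever \<open>L\<close> is.\<close>
    also have "\<dots> \<le> (\<integral>x. D * norm (G x) powr q \<partial>lborel_pos)"
    proof (rule integral_mono)
      fix x :: real assume "x \<in> space lborel_pos"
      then have x: "0 < x" by (simp add: space_restrict_space)
      show "(\<Sum>m<L. (z m * x) powr q * exp (- (1 / 2 * z m * x)) * norm (G x) powr q) \<le> D * norm (G x) powr q"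
        unfolding sum_distrib_right[symmetric] by (intro mult_right_mono D(2)[OF z x]) auto
    qed (use int_term zp intGq in auto)
    finally show ?thesis
      using \<open>0 < K\<close> by (simp add: mult.assoc)
  qed
  show ?thesis
  proof (rule that[of "K * D"])
    show "0 < K * D" using \<open>0 < K\<close> D(1) by simp
  qed (rule main; assumption)
qed

text \<open>The matrix in \<open>diagonal_dominance\<close> consists of the pairings of
  \<open>exp (- (z n * x))\<close> with the dilated kernels \<open>z m * k (z m * x)\<close>. Hence
  the pairings of the whole sum form the image of \<open>a\<close> under this matrix, and
  \<open>kernel_pairing_bound\<close> estimates them by the integral.\<close>

lemma lacunary_exp_sum_lower_bound:
  assumes r: "1 < r" and q: "1 \<le> q"
  shows "\<exists>C>0. \<forall>z (a :: nat \<Rightarrow> complex) L. lacunary r z \<longrightarrow>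
    (\<Sum>n<L. norm (a n) powr q / z n)
      \<le> C * (\<integral>x. norm (\<Sum>n<L. a n * of_real (exp (- (z n * x)))) powr q \<partial>lborel_pos)"
proof -
  obtain N where "2 \<le> N" and "\<forall>z (a :: nat \<Rightarrow> complex) L. lacunary r z \<longrightarrow>
    (\<Sum>n<L. norm (a n) powr q / z n)
      \<le> 2 powr q * (\<Sum>m<L. norm (\<Sum>n<L. a n * of_real ((4 * z n * z m / (z n + z m)\<^sup>2) ^ N)) powr q / z m)"
    using diagonal_dominance[OF r q] by (elim exE conjE) (rule that)
  note N = this(1) this(2)[rule_format]
  obtain k C0 where k: "k \<in> borel_measurable borel" "0 < C0"
    "\<And>y. 0 \<le> y \<Longrightarrow> \<bar>k y\<bar> \<le> C0 * y * exp (- (y / 2))"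
    "\<And>A B. 0 < A \<Longrightarrow> 0 < B \<Longrightarrow>
      has_bochner_integral lborel_pos (\<lambda>x. exp (- (A * x)) * (B * k (B * x))) ((4 * A * B / (A + B)\<^sup>2) ^ N)"
    by (rule exists_kernel[OF N(1)]) (rule that; assumption)
  obtain C where C: "0 < C"
    "\<And>z L (G :: real \<Rightarrow> complex) A c. lacunary r z \<Longrightarrow> G \<in> borel_measurable borel \<Longrightarrow> 0 < c \<Longrightarrow>
      (\<forall>x>0. norm (G x) \<le> A * exp (- (c * x))) \<Longrightarrow>
      (\<Sum>m<L. norm (\<integral>x. G x * of_real (z m * k (z m * x)) \<partial>lborel_pos) powr q / z m)
        \<le> C * (\<integral>x. norm (G x) powr q \<partial>lborel_pos)"
  proof (rule kernel_pairing_bound[OF r q k(1,2)])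
    show "\<bar>k y\<bar> \<le> C0 * y * exp (- (y / 2))" if "0 \<le> y" for y
      using that by (rule k(3))
  qed (rule that; assumption)
  have "(\<Sum>n<L. norm (a n) powr q / z n)
      \<le> 2 powr q * C * (\<integral>x. norm (\<Sum>n<L. a n * of_real (exp (- (z n * x)))) powr q \<partial>lborel_pos)"
    if z: "lacunary r z" for z and a :: "nat \<Rightarrow> complex" and L
  proof -
    define G where "G x = (\<Sum>n<L. a n * of_real (exp (- (z n * x))))" for x
    have zp: "0 < z n" for n using lacunary_pos[OF z] .
    have Gm: "G \<in> borel_measurable borel" unfolding G_def by measurable
    \<comment> \<open>\<open>z 0\<close> is the smallest exponent and so a common decay
      rate.\<close>
    have Gb: "\<forall>x>0. norm (G x) \<le> (\<Sum>n<L. norm (a n)) * exp (- (z 0 * x))"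
      unfolding G_def sum_distrib_right
      using lacunary_mono[OF z r, of 0]
      by (intro allI impI sum_norm_le) (auto simp: norm_mult intro!: mult_left_mono)
    have "(\<integral>x. G x * of_real (z m * k (z m * x)) \<partial>lborel_pos)
      = (\<Sum>n<L. a n * of_real ((4 * z n * z m / (z n + z m)\<^sup>2) ^ N))" for m
    proof -
      have "has_bochner_integral lborel_pos
        (\<lambda>x. \<Sum>n<L. a n * complex_of_real (exp (- (z n * x)) * (z m * k (z m * x))))
        (\<Sum>n<L. a n * of_real ((4 * z n * z m / (z n + z m)\<^sup>2) ^ N))"
        by (intro has_bochner_integral_sum has_bochner_integral_mult_right
            has_bochner_integral_of_real k(4) zp)
      moreover have "G x * of_real (z m * k (z m * x))
        = (\<Sum>n<L. a n * complex_of_real (exp (- (z n * x)) * (z m * k (z m * x))))" for x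
        by (simp add: G_def sum_distrib_right mult.assoc)
      ultimately show ?thesis
        by (simp only: has_bochner_integral_iff)
    qed
    then have "(\<Sum>m<L. norm (\<Sum>n<L. a n * of_real ((4 * z n * z m / (z n + z m)\<^sup>2) ^ N)) powr q / z m)
      \<le> C * (\<integral>x. norm (G x) powr q \<partial>lborel_pos)"
      using C(2)[OF z Gm zp[of 0] Gb, of L] by simp
    then have "2 powr q * (\<Sum>m<L. norm (\<Sum>n<L. a n * of_real ((4 * z n * z m / (z n + z m)\<^sup>2) ^ N)) powr q / z m)
      \<le> 2 powr q * (C * (\<integral>x. norm (G x) powr q \<partial>lborel_pos))"
      by (intro mult_left_mono) auto
    from order_trans[OF N(2)[OF z, of a L] this] show ?thesis
      unfolding G_def mult.assoc .
  qed
  then show ?thesis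
    using C(1) by (intro exI[of _ "2 powr q * C"] conjI allI impI) simp_all
qed

section \<open>Lower bound for Muntz polynomials\<close>

text \<open>The substitution \<open>t = exp (- x)\<close> maps the half-line onto the open unit
  interval, and the end points are null sets. The change of variables is carried out for gauge
  integrals of absolutely integrable functions, so both Lebesgue integrals are converted first;
  boundedness of \<open>g\<close> gives their integrability.\<close>

lemma integral_leb01_exp:
  fixes g :: "real \<Rightarrow> real"
  assumes g: "g \<in> borel_measurable borel" and b: "\<And>t. t \<in> {0..1} \<Longrightarrow> \<bar>g t\<bar> \<le> B"
  shows "integrable leb01 g"
    "(\<integral>t. g t \<partial>leb01) = (\<integral>x. exp (- x) * g (exp (- x)) \<partial>lborel_pos)"
proof -
  note [measurable] = g
  show int: "integrable leb01 g"
  proof (rule Bochner_Integration.integrable_bound)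
    show "integrable leb01 (\<lambda>_. B)"
      by (simp add: leb01_def integrable_restrict_space)
    show "AE t in leb01. norm (g t) \<le> norm B"
      by (rule AE_I2) (use b in \<open>fastforce simp: leb01_def space_restrict_space\<close>)
  qed (auto simp: leb01_def intro!: measurable_restrict_space1)
  have img: "(\<lambda>x. exp (- x)) ` {0<..} = {0<..<1::real}"
  proof (intro equalityI subsetI)
    fix y :: real assume "y \<in> {0<..<1}"
    then show "y \<in> (\<lambda>x. exp (- x)) ` {0<..}"
      by (intro image_eqI[of _ _ "- ln y"]) auto
  qed auto
  have "integrable lborel_pos (\<lambda>x. exp (- x) * g (exp (- x)))"
    using b by (intro integrable_exp_bound[of _ 1 B]) (auto simp: abs_mult mult.commute)
  then have si: "set_integrable lborel {0<..} (\<lambda>x. exp (- x) * g (exp (- x)))"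
    by (simp add: integrable_restrict_space set_integrable_def)
  then have ai: "(\<lambda>x. \<bar>- exp (- x)\<bar> * g (exp (- x))) absolutely_integrable_on {0<..}"
    unfolding set_integrable_def by (subst integrable_completion) auto
  have der: "((\<lambda>x. exp (- x)) has_real_derivative - exp (- x)) (at x within {0<..})" for x :: real
    by (auto intro!: derivative_eq_intros)
  have inj: "inj_on (\<lambda>x::real. exp (- x)) {0<..}"
    by (simp add: inj_on_def)
  have "integral {0<..<1} g = integral {0<..} (\<lambda>x. \<bar>- exp (- x)\<bar> * g (exp (- x)))"
    using has_absolute_integral_change_of_variables_1'[OF _ der inj, THEN iffD1, OF _ conjI[OF ai refl]]
    unfolding img by simp
  also have "\<dots> = (\<integral>x. exp (- x) * g (exp (- x)) \<partial>lborel_pos)"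
    using set_borel_integral_eq_integral(2)[OF si]
    by (simp add: integral_restrict_space set_lebesgue_integral_def)
  finally have "integral {0<..<1} g = (\<integral>x. exp (- x) * g (exp (- x)) \<partial>lborel_pos)" .
  moreover have si': "set_integrable lborel {0<..<1} g"
  proof (rule set_integrable_subset)
    show "set_integrable lborel {0..1} g"
      using int by (simp add: leb01_def integrable_restrict_space set_integrable_def)
  qed auto
  moreover have "(\<integral>t. g t \<partial>leb01) = (LINT t:{0<..<1}|lborel. g t)"
    unfolding leb01_def set_lebesgue_integral_def
  proof (subst integral_restrict_space, simp, rule integral_cong_AE)
    show "AE t in lborel. indicator {0..1} t *\<^sub>R g t = indicator {0<..<1} t *\<^sub>R g t"
      by (rule AE_mp[OF AE_lborel_singleton[of 0]], rule AE_mp[OF AE_lborel_singleton[of 1]])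
        (auto simp: indicator_def intro!: AE_I2)
  qed auto
  ultimately show "(\<integral>t. g t \<partial>leb01) = (\<integral>x. exp (- x) * g (exp (- x)) \<partial>lborel_pos)"
    using set_borel_integral_eq_integral(2)[OF si'] by simp
qed

lemma norm_muntz_polynomial_le:
  fixes a :: "nat \<Rightarrow> complex"
  assumes "\<And>n. 0 < \<Lambda> n" "t \<in> {0..1}"
  shows "norm (\<Sum>n<L. a n * of_real (t powr \<Lambda> n)) \<le> (\<Sum>n<L. norm (a n))"
  using assms by (intro sum_norm_le) (auto simp: norm_mult less_imp_le intro!: mult_left_le powr_le1)

text \<open>The bound for exponential sums is applied to the shifted exponents
  \<open>\<Lambda> n + 1 / q\<close>. Because every \<open>\<Lambda> n\<close> is at least
  \<open>\<Lambda> 0 > 0\<close>, the shifted sequence is still lacunary and its weights are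
  comparable to the original ones.\<close>

lemma muntz_polynomial_lower_bound:
  assumes r: "1 < r" and q: "1 \<le> q" and lac: "lacunary r \<Lambda>"
  shows "\<exists>C>0. \<forall>(a :: nat \<Rightarrow> complex) L. (\<Sum>n<L. norm (a n) powr q / \<Lambda> n)
      \<le> C * (\<integral>t. norm (\<Sum>n<L. a n * of_real (t powr \<Lambda> n)) powr q \<partial>leb01)"
proof -
  have \<Lambda>: "0 < \<Lambda> n" "\<Lambda> 0 \<le> \<Lambda> n" "r * \<Lambda> n \<le> \<Lambda> (Suc n)" for n
    using lacunary_pos[OF lac] lacunary_mono[OF lac r] lac by (auto simp: lacunary_def)
  \<comment> \<open>The shift by \<open>1 / q\<close> absorbs the Jacobian \<open>exp (- x)\<close> of \<open>t = exp (- x)\<close>.\<close>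
  define z where "z n = \<Lambda> n + 1 / q" for n
  \<comment> \<open>For \<open>c = 1 / q\<close>, the quotient \<open>(r * y + c) / (y + c)\<close>
    increases with \<open>y\<close>, so its value at \<open>y = \<Lambda> 0\<close> is a lower bound
    for all shifted ratios.\<close>
  define r' where "r' = (r * \<Lambda> 0 + 1 / q) / z 0"
  have zp: "0 < z n" for n
    using \<Lambda>(1)[of n] q by (simp add: z_def add_pos_pos)
  have "1 < r'"
    using \<Lambda>(1)[of 0] r zp[of 0] by (simp add: r'_def) (simp add: z_def)
  have "lacunary r' z"
    unfolding lacunary_def
  proof (intro conjI allI)
    fix n
    have "0 \<le> (1 / q) * (r - 1) * (\<Lambda> n - \<Lambda> 0)"
      using \<Lambda>(2)[of n] r q by (intro mult_nonneg_nonneg) auto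
    then have "(r * \<Lambda> 0 + 1 / q) * z n \<le> (r * \<Lambda> n + 1 / q) * z 0"
      by (simp add: z_def algebra_simps add_divide_distrib diff_divide_distrib)
    also have "\<dots> \<le> z (Suc n) * z 0"
      using \<Lambda>(3)[of n] zp[of 0] by (intro mult_right_mono) (auto simp: z_def)
    finally show "r' * z n \<le> z (Suc n)"
      using zp[of 0] by (simp add: r'_def divide_le_eq)
  qed (use zp in auto)
  obtain C where "0 < C" and "\<forall>z (a :: nat \<Rightarrow> complex) L. lacunary r' z \<longrightarrow>
      (\<Sum>n<L. norm (a n) powr q / z n)
        \<le> C * (\<integral>x. norm (\<Sum>n<L. a n * of_real (exp (- (z n * x)))) powr q \<partial>lborel_pos)"
    using lacunary_exp_sum_lower_bound[OF \<open>1 < r'\<close> q] by (elim exE conjE) (rule that)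
  note C = this(1) this(2)[rule_format, OF \<open>lacunary r' z\<close>]
  \<comment> \<open>Makes \<open>z n \<le> D * \<Lambda> n\<close>, in order to return from the
    weights \<open>1 / z n\<close> to \<open>1 / \<Lambda> n\<close>.\<close>
  define D where "D = 1 + 1 / (q * \<Lambda> 0)"
  have D: "0 < D" using \<Lambda>(1)[of 0] q by (simp add: D_def add_pos_nonneg)
  have "(\<Sum>n<L. norm (a n) powr q / \<Lambda> n)
      \<le> D * C * (\<integral>t. norm (\<Sum>n<L. a n * of_real (t powr \<Lambda> n)) powr q \<partial>leb01)" for a :: "nat \<Rightarrow> complex" and L
  proof -
    define g where "g t = norm (\<Sum>n<L. a n * of_real (t powr \<Lambda> n)) powr q" for t
    have "(\<Sum>n<L. norm (a n) powr q / \<Lambda> n) \<le> (\<Sum>n<L. D * (norm (a n) powr q / z n))"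
    proof (rule sum_mono)
      fix n
      have "\<Lambda> n / (q * \<Lambda> 0) \<ge> 1 / q"
        using \<Lambda>(1)[of 0] \<Lambda>(2)[of n] q by (simp add: field_simps)
      then have "z n \<le> D * \<Lambda> n"
        by (simp add: z_def D_def algebra_simps)
      then have "1 / \<Lambda> n \<le> D / z n"
        using zp[of n] \<Lambda>(1)[of n] by (simp add: field_simps)
      then have "norm (a n) powr q * (1 / \<Lambda> n) \<le> norm (a n) powr q * (D / z n)"
        by (rule mult_left_mono) simp
      then show "norm (a n) powr q / \<Lambda> n \<le> D * (norm (a n) powr q / z n)"
        by (simp add: mult.commute)
    qed
    also have "\<dots> = D * (\<Sum>n<L. norm (a n) powr q / z n)"
      by (simp only: sum_distrib_left)
    also have "\<dots> \<le> D * (C * (\<integral>x. norm (\<Sum>n<L. a n * of_real (exp (- (z n * x)))) powr q \<partial>lborel_pos))"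
      using C(2)[of a L] D by (intro mult_left_mono) auto
    also have "(\<integral>x. norm (\<Sum>n<L. a n * of_real (exp (- (z n * x)))) powr q \<partial>lborel_pos)
      = (\<integral>x. exp (- x) * g (exp (- x)) \<partial>lborel_pos)"
    proof (rule Bochner_Integration.integral_cong[OF refl])
      fix x :: real
      have "(\<Sum>n<L. a n * complex_of_real (exp (- (z n * x))))
        = of_real (exp (- (x / q))) * (\<Sum>n<L. a n * of_real (exp (- x) powr \<Lambda> n))"
      proof -
        have "exp (- (z n * x)) = exp (- (x / q)) * exp (- x) powr \<Lambda> n" for n
          by (simp add: z_def exp_powr_real exp_add[symmetric] algebra_simps)
        then show ?thesis
          by (simp add: sum_distrib_left mult_ac)
      qed
      moreover have "exp (- (x / q)) powr q = exp (- x)"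
        using q by (simp add: exp_powr_real)
      ultimately show "norm (\<Sum>n<L. a n * complex_of_real (exp (- (z n * x)))) powr q = exp (- x) * g (exp (- x))"
        by (simp add: g_def norm_mult powr_mult)
    qed
    also have "\<dots> = (\<integral>t. g t \<partial>leb01)"
    proof (rule integral_leb01_exp(2)[symmetric])
      show "g \<in> borel_measurable borel"
        unfolding g_def by measurable
      fix t :: real assume t: "t \<in> {0..1}"
      show "\<bar>g t\<bar> \<le> (\<Sum>n<L. norm (a n)) powr q"
        using q norm_muntz_polynomial_le[of \<Lambda> t a L, OF \<Lambda>(1) t] by (auto simp: g_def intro!: powr_mono2)
    qed
    finally show ?thesis by (simp add: g_def mult.assoc)
  qed
  then show ?thesis
    using C(1) D by (intro exI[of _ "D * C"] conjI allI impI) simp_all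
qed

section \<open>Upper bound for Muntz polynomials\<close>

text \<open>Jensen's inequality with the weights \<open>\<Lambda> n powr s\<close>, whose sum is
  dominated by the last one. What remains is the factor
  \<open>(\<Lambda> n / \<Lambda> K) powr (1/2)\<close>, which later makes the sum over the upper
  index converge.\<close>

lemma low_frequency_sum_powr_le:
  assumes r: "1 < r" and q: "1 < q" and lac: "lacunary r \<Lambda>"
  shows "\<exists>C>0. \<forall>c K. (\<forall>n. 0 \<le> c n) \<longrightarrow>
    (\<Sum>n\<le>K. c n) powr q \<le> C * (\<Sum>n\<le>K. c n powr q / \<Lambda> n * ((\<Lambda> n / \<Lambda> K) powr (1/2) * \<Lambda> K))"
proof -
  \<comment> \<open>With this \<open>s\<close> the weight sum to the power \<open>q - 1\<close> is
    of order \<open>\<Lambda> K powr (1 / 2)\<close>, and the exponent left on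
    \<open>\<Lambda> n\<close> is \<open>s - s * q = - (1 / 2)\<close>.\<close>
  define s where "s = 1 / (2 * (q - 1))"
  have s: "0 < s" "s * (q - 1) = 1 / 2" using q by (auto simp: s_def)
  have \<Lambda>: "0 < \<Lambda> n" for n using lacunary_pos[OF lac] .
  define R where "R = r powr s"
  have R: "1 < R" using r s by (simp add: R_def)
  define C where "C = (R / (R - 1)) powr (q - 1)"
  have "0 < C" using R by (simp add: C_def)
  have lac': "lacunary R (\<lambda>n. \<Lambda> n powr s)"
    using lacunary_powr[OF lac _ s(1), of 1] r by (simp add: R_def)
  have main: "(\<Sum>n\<le>K. c n) powr q \<le> C * (\<Sum>n\<le>K. c n powr q / \<Lambda> n * ((\<Lambda> n / \<Lambda> K) powr (1/2) * \<Lambda> K))"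
    if c: "\<forall>n. 0 \<le> c n" for c :: "nat \<Rightarrow> real" and K
  proof -
    have "(\<Sum>n\<le>K. c n) = (\<Sum>n\<le>K. \<Lambda> n powr s * (c n / \<Lambda> n powr s))"
      using \<Lambda> by (simp add: less_imp_neq[THEN not_sym])
    also have "\<dots> powr q \<le> (\<Sum>n\<le>K. \<Lambda> n powr s) powr (q - 1) * (\<Sum>n\<le>K. \<Lambda> n powr s * (c n / \<Lambda> n powr s) powr q)"
      using q c by (intro sum_mult_powr_le) auto
    also have "\<dots> \<le> (R / (R - 1) * \<Lambda> K powr s) powr (q - 1) * (\<Sum>n\<le>K. \<Lambda> n powr s * (c n / \<Lambda> n powr s) powr q)"
      using q lacunary_sum_le[OF lac' R, of K]
      by (intro mult_right_mono powr_mono2 sum_nonneg) auto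
    also have "(R / (R - 1) * \<Lambda> K powr s) powr (q - 1) = C * \<Lambda> K powr (1 / 2)"
    proof -
      have "(\<Lambda> K powr s) powr (q - 1) = \<Lambda> K powr (1 / 2)"
        by (simp only: powr_powr s(2))
      then show ?thesis
        using powr_mult[of "R / (R - 1)" "\<Lambda> K powr s" "q - 1"] R by (simp add: C_def)
    qed
    also have "C * \<Lambda> K powr (1 / 2) * (\<Sum>n\<le>K. \<Lambda> n powr s * (c n / \<Lambda> n powr s) powr q)
      = C * (\<Sum>n\<le>K. \<Lambda> K powr (1 / 2) * (\<Lambda> n powr s * (c n / \<Lambda> n powr s) powr q))"
      by (simp only: sum_distrib_left mult.assoc)
    also have "(\<Sum>n\<le>K. \<Lambda> K powr (1 / 2) * (\<Lambda> n powr s * (c n / \<Lambda> n powr s) powr q))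
      = (\<Sum>n\<le>K. c n powr q / \<Lambda> n * ((\<Lambda> n / \<Lambda> K) powr (1/2) * \<Lambda> K))"
    proof (rule sum.cong[OF refl])
      fix n
      have "(c n / \<Lambda> n powr s) powr q = c n powr q * \<Lambda> n powr - (s * q)"
        using c by (simp add: powr_divide powr_powr powr_minus_divide)
      then have "\<Lambda> n powr s * (c n / \<Lambda> n powr s) powr q = c n powr q * (\<Lambda> n powr s * \<Lambda> n powr - (s * q))"
        by simp
      also have "s + - (s * q) = - (1/2)"
        using s(2) by (simp add: algebra_simps)
      then have "\<Lambda> n powr s * \<Lambda> n powr - (s * q) = \<Lambda> n powr (- (1/2))"
        by (simp only: powr_add[symmetric])
      also have "\<Lambda> n powr (- (1/2)) = \<Lambda> n powr (1/2) / \<Lambda> n"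
        using powr_diff[of "\<Lambda> n" "1/2" 1] \<Lambda>[of n] by simp
      finally have "\<Lambda> K powr (1/2) * (\<Lambda> n powr s * (c n / \<Lambda> n powr s) powr q)
        = c n powr q / \<Lambda> n * (\<Lambda> n powr (1/2) * \<Lambda> K powr (1/2))"
        by simp
      also have "\<Lambda> K powr (1/2) * \<Lambda> K powr (1/2) = \<Lambda> K"
        using \<Lambda>[of K] by (simp add: powr_add[symmetric])
      then have "\<Lambda> n powr (1/2) * \<Lambda> K powr (1/2) = (\<Lambda> n / \<Lambda> K) powr (1/2) * \<Lambda> K"
        using \<Lambda>[of n] \<Lambda>[of K] by (simp add: powr_divide field_simps)
      finally show "\<Lambda> K powr (1 / 2) * (\<Lambda> n powr s * (c n / \<Lambda> n powr s) powr q)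
        = c n powr q / \<Lambda> n * ((\<Lambda> n / \<Lambda> K) powr (1/2) * \<Lambda> K)" .
    qed
    finally show ?thesis .
  qed
  show ?thesis
    by (intro exI[of _ C] conjI[OF \<open>0 < C\<close>] allI impI) (rule main; assumption)
qed

text \<open>Jensen's inequality with the weights \<open>1 / \<Lambda> n\<close>, whose sum from
  \<open>J\<close> on is at most a constant times \<open>1 / \<Lambda> J \<le> x\<close>. The
  resulting factor \<open>(\<Lambda> n * x) powr (q - 1)\<close> is absorbed by
  \<open>exp (- ((q - p) * (\<Lambda> n * x)))\<close>, which decays because
  \<open>p < q\<close>.\<close>

lemma high_frequency_sum_powr_le:
  assumes r: "1 < r" and q: "1 \<le> p" "p < q" and lac: "lacunary r \<Lambda>"
  shows "\<exists>C>0. \<forall>c x J L. (\<forall>n. 0 \<le> c n) \<longrightarrow> 0 < x \<longrightarrow> 1 \<le> \<Lambda> J * x \<longrightarrow>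
    (\<Sum>n\<in>{J..<L}. c n * exp (- (\<Lambda> n * x))) powr q
      \<le> C * (\<Sum>n\<in>{J..<L}. c n powr q / \<Lambda> n * (\<Lambda> n * exp (- (p * \<Lambda> n * x))))"
proof -
  have \<Lambda>: "0 < \<Lambda> n" for n using lacunary_pos[OF lac] .
  define R where "R = (r / (r - 1)) powr (q - 1)"
  define B where "B = ((q - 1) / (q - p)) powr (q - 1)"
  have "0 < R" "0 < B" using r q by (simp_all add: R_def B_def)
  have main: "(\<Sum>n\<in>{J..<L}. c n * exp (- (\<Lambda> n * x))) powr q
      \<le> R * B * (\<Sum>n\<in>{J..<L}. c n powr q / \<Lambda> n * (\<Lambda> n * exp (- (p * \<Lambda> n * x))))"
    if c: "\<forall>n. 0 \<le> c n" and x: "0 < x" and J: "1 \<le> \<Lambda> J * x" for c :: "nat \<Rightarrow> real" and x J L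
  proof -
    define u where "u n = c n * \<Lambda> n * exp (- (\<Lambda> n * x))" for n
    have u0: "0 \<le> u n" for n using c \<Lambda>[of n] by (simp add: u_def)
    have "(\<Sum>n\<in>{J..<L}. c n * exp (- (\<Lambda> n * x))) = (\<Sum>n\<in>{J..<L}. 1 / \<Lambda> n * u n)"
      using \<Lambda> by (simp add: u_def less_imp_neq[THEN not_sym])
    also have "\<dots> powr q \<le> (\<Sum>n\<in>{J..<L}. 1 / \<Lambda> n) powr (q - 1) * (\<Sum>n\<in>{J..<L}. 1 / \<Lambda> n * u n powr q)"
      using q u0 \<Lambda> by (intro sum_mult_powr_le) (auto simp: less_imp_le)
    also have "\<dots> \<le> (r / (r - 1) / \<Lambda> J) powr (q - 1) * (\<Sum>n\<in>{J..<L}. 1 / \<Lambda> n * u n powr q)"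
      using q \<Lambda> lacunary_sum_inverse_le[OF lac r]
      by (intro mult_right_mono powr_mono2 sum_nonneg) (auto simp: less_imp_le)
    also have "(r / (r - 1) / \<Lambda> J) powr (q - 1) = R * (1 / \<Lambda> J) powr (q - 1)"
      using r \<Lambda>[of J] powr_mult[of "r / (r - 1)" "1 / \<Lambda> J" "q - 1"] by (simp add: R_def)
    also have "R * (1 / \<Lambda> J) powr (q - 1) * (\<Sum>n\<in>{J..<L}. 1 / \<Lambda> n * u n powr q)
      = R * (\<Sum>n\<in>{J..<L}. (1 / \<Lambda> J) powr (q - 1) * (1 / \<Lambda> n * u n powr q))"
      by (simp only: sum_distrib_left mult.assoc)
    also have "\<dots> \<le> R * (\<Sum>n\<in>{J..<L}. B * (c n powr q / \<Lambda> n * (\<Lambda> n * exp (- (p * \<Lambda> n * x)))))"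
    proof (intro mult_left_mono sum_mono)
      fix n assume n: "n \<in> {J..<L}"
      define X where "X = c n powr q"
      have "0 \<le> X" by (simp add: X_def)
      \<comment> \<open>The part \<open>p\<close> of the exponent is kept for the condition on the
        measure; the part \<open>q - p\<close> is spent on the bound \<open>B\<close>.\<close>
      have e: "exp (- (\<Lambda> n * x)) powr q = exp (- ((q - p) * (\<Lambda> n * x))) * exp (- (p * \<Lambda> n * x))"
        by (simp add: exp_powr_real exp_add[symmetric] algebra_simps)
      have "\<Lambda> n powr q = \<Lambda> n powr (q - 1) * \<Lambda> n"
        using \<Lambda>[of n] by (simp add: powr_diff)
      then have uq: "u n powr q = c n powr q * \<Lambda> n * \<Lambda> n powr (q - 1) * exp (- ((q - p) * (\<Lambda> n * x))) * exp (- (p * \<Lambda> n * x))"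
        using c \<Lambda>[of n] by (simp add: u_def powr_mult e)
      have "1 / \<Lambda> J \<le> x"
        using J \<Lambda>[of J] by (simp add: field_simps)
      then have "(1 / \<Lambda> J) powr (q - 1) \<le> x powr (q - 1)"
        using q \<Lambda>[of J] by (intro powr_mono2) auto
      then have "(1 / \<Lambda> J) powr (q - 1) * (\<Lambda> n powr (q - 1) * exp (- ((q - p) * (\<Lambda> n * x))))
        \<le> x powr (q - 1) * (\<Lambda> n powr (q - 1) * exp (- ((q - p) * (\<Lambda> n * x))))"
        by (rule mult_right_mono) simp
      also have "\<dots> = (\<Lambda> n * x) powr (q - 1) * exp (- ((q - p) * (\<Lambda> n * x)))"
        using x \<Lambda>[of n] by (simp add: powr_mult)
      also have "\<dots> \<le> B"
        unfolding B_def using q x \<Lambda>[of n] by (intro powr_mult_exp_minus_scaled_le) auto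
      finally have "(1 / \<Lambda> J) powr (q - 1) * (\<Lambda> n powr (q - 1) * exp (- ((q - p) * (\<Lambda> n * x)))) \<le> B" .
      then have "(1 / \<Lambda> J) powr (q - 1) * (\<Lambda> n powr (q - 1) * exp (- ((q - p) * (\<Lambda> n * x)))) * (X * exp (- (p * \<Lambda> n * x)))
        \<le> B * (X * exp (- (p * \<Lambda> n * x)))"
        using \<open>0 \<le> X\<close> by (intro mult_right_mono) auto
      moreover have "1 / \<Lambda> n * u n powr q = \<Lambda> n powr (q - 1) * exp (- ((q - p) * (\<Lambda> n * x))) * (X * exp (- (p * \<Lambda> n * x)))"
        using \<Lambda>[of n] by (simp add: uq X_def)
      moreover have "c n powr q / \<Lambda> n * (\<Lambda> n * exp (- (p * \<Lambda> n * x))) = X * exp (- (p * \<Lambda> n * x))"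
        using \<Lambda>[of n] by (simp add: X_def)
      ultimately show "(1 / \<Lambda> J) powr (q - 1) * (1 / \<Lambda> n * u n powr q)
        \<le> B * (c n powr q / \<Lambda> n * (\<Lambda> n * exp (- (p * \<Lambda> n * x))))"
        by (simp only: mult.assoc)
    qed (use \<open>0 < R\<close> in auto)
    also have "\<dots> = R * B * (\<Sum>n\<in>{J..<L}. c n powr q / \<Lambda> n * (\<Lambda> n * exp (- (p * \<Lambda> n * x))))"
      by (simp only: sum_distrib_left[symmetric] mult.assoc)
    finally show ?thesis .
  qed
  have "0 < R * B" using \<open>0 < R\<close> \<open>0 < B\<close> by simp
  show ?thesis
    by (intro exI[of _ "R * B"] conjI[OF \<open>0 < R * B\<close>] allI impI) (rule main; assumption)
qed

text \<open>Each part of the split sum is matched with single terms of the inner sum. The low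
  frequencies use \<open>k = K\<close>, the last low index, where
  \<open>exp (- (p * \<Lambda> K * x))\<close> is at least \<open>exp (- p)\<close>; the high ones
  use the diagonal term \<open>k = n\<close>. If no index below \<open>L\<close> is high, then
  \<open>J = L\<close> and the second part is empty.\<close>

lemma exp_sum_powr_le:
  assumes r: "1 < r" and q: "1 \<le> p" "p < q" and lac: "lacunary r \<Lambda>"
  shows "\<exists>C>0. \<forall>c x L. (\<forall>n. 0 \<le> c n) \<longrightarrow> 0 < x \<longrightarrow>
    (\<Sum>n<L. c n * exp (- (\<Lambda> n * x))) powr q
      \<le> C * (\<Sum>n<L. c n powr q / \<Lambda> n *
          (\<Sum>k\<in>{n..<L}. (\<Lambda> n / \<Lambda> k) powr (1/2) * (\<Lambda> k * exp (- (p * \<Lambda> k * x)))))"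
proof -
  have \<Lambda>: "0 < \<Lambda> n" for n using lacunary_pos[OF lac] .
  have "1 < q" using q by simp
  obtain C1 where C1: "0 < C1" and "\<forall>c K. (\<forall>n. 0 \<le> c n) \<longrightarrow>
    (\<Sum>n\<le>K. c n) powr q \<le> C1 * (\<Sum>n\<le>K. c n powr q / \<Lambda> n * ((\<Lambda> n / \<Lambda> K) powr (1/2) * \<Lambda> K))"
    using low_frequency_sum_powr_le[OF r \<open>1 < q\<close> lac] by (elim exE conjE) (rule that)
  note low = this(2)[rule_format]
  obtain C2 where C2: "0 < C2" and "\<forall>c x J L. (\<forall>n. 0 \<le> c n) \<longrightarrow> 0 < x \<longrightarrow> 1 \<le> \<Lambda> J * x \<longrightarrow>
    (\<Sum>n\<in>{J..<L}. c n * exp (- (\<Lambda> n * x))) powr q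
      \<le> C2 * (\<Sum>n\<in>{J..<L}. c n powr q / \<Lambda> n * (\<Lambda> n * exp (- (p * \<Lambda> n * x))))"
    using high_frequency_sum_powr_le[OF r q lac] by (elim exE conjE) (rule that)
  note high = this(2)[rule_format]
  \<comment> \<open>\<open>exp p\<close> pays for inserting the exponential at the last low
    frequency, \<open>2 powr (q - 1)\<close> for splitting the sum in two.\<close>
  define C where "C = 2 powr (q - 1) * (C1 * exp p + C2)"
  have "0 < C" using C1 C2 by (simp add: C_def add_pos_pos)
  have main: "(\<Sum>n<L. c n * exp (- (\<Lambda> n * x))) powr q
      \<le> C * (\<Sum>n<L. c n powr q / \<Lambda> n *
          (\<Sum>k\<in>{n..<L}. (\<Lambda> n / \<Lambda> k) powr (1/2) * (\<Lambda> k * exp (- (p * \<Lambda> k * x)))))"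
    (is "_ \<le> C * ?S")
    if c: "\<forall>n. 0 \<le> c n" and x: "0 < x" for c :: "nat \<Rightarrow> real" and x L
  proof -
    define E where "E k = \<Lambda> k * exp (- (p * \<Lambda> k * x))" for k
    have E0: "0 \<le> E k" for k using \<Lambda>[of k] by (simp add: E_def)
    define T where "T n = (\<Sum>k\<in>{n..<L}. (\<Lambda> n / \<Lambda> k) powr (1/2) * E k)" for n
    have T0: "0 \<le> T n" for n unfolding T_def using E0 by (intro sum_nonneg) auto
    have T_ge: "(\<Lambda> n / \<Lambda> k) powr (1/2) * E k \<le> T n" if "n \<le> k" "k < L" for n k
      unfolding T_def using that E0 by (intro member_le_sum) auto
    have S: "?S = (\<Sum>n<L. c n powr q / \<Lambda> n * T n)"
      by (simp add: T_def E_def)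
    have term0: "0 \<le> c n powr q / \<Lambda> n * T n" for n
      using T0[of n] \<Lambda>[of n] by simp
    have S0: "0 \<le> ?S" unfolding S using term0 by (intro sum_nonneg) auto
    \<comment> \<open>\<open>J\<close> separates the low frequencies \<open>\<Lambda> n * x \<le> 1\<close> from the high ones.\<close>
    define J where "J = (LEAST j. j = L \<or> 1 < \<Lambda> j * x)"
    have "J = L \<or> 1 < \<Lambda> J * x"
      unfolding J_def by (rule LeastI[of _ L]) simp
    moreover have "J \<le> L" unfolding J_def by (rule Least_le) simp
    moreover have below: "\<Lambda> n * x \<le> 1" if "n < J" for n
      using not_less_Least[OF that[unfolded J_def]] by auto
    ultimately have J: "J = L \<or> 1 \<le> \<Lambda> J * x" "J \<le> L" by auto
    define u v where "u = (\<Sum>n<J. c n * exp (- (\<Lambda> n * x)))"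
      and "v = (\<Sum>n\<in>{J..<L}. c n * exp (- (\<Lambda> n * x)))"
    have "(\<Sum>n<L. c n * exp (- (\<Lambda> n * x))) = u + v"
      unfolding u_def v_def lessThan_atLeast0 using J(2) by (simp add: sum.atLeastLessThan_concat)
    moreover have "0 \<le> u" "0 \<le> v"
      using c by (auto simp: u_def v_def intro!: sum_nonneg)
    ultimately have "(\<Sum>n<L. c n * exp (- (\<Lambda> n * x))) powr q \<le> 2 powr (q - 1) * (u powr q + v powr q)"
      using add_powr_le[of q u v] q by simp
    also have "\<dots> \<le> 2 powr (q - 1) * (C1 * exp p * ?S + C2 * ?S)"
    proof (intro mult_left_mono add_mono)
      show "u powr q \<le> C1 * exp p * ?S"
      proof (cases J)
        case 0
        then show ?thesis using S0 C1 by (simp add: u_def)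
      next
        case (Suc K)
        have "u \<le> (\<Sum>n\<le>K. c n)"
          unfolding u_def Suc lessThan_Suc_atMost using c x \<Lambda>
          by (intro sum_mono mult_left_le) (auto simp: less_imp_le)
        then have "u powr q \<le> (\<Sum>n\<le>K. c n) powr q"
          using \<open>0 \<le> u\<close> q by (intro powr_mono2) auto
        also have "\<dots> \<le> C1 * (\<Sum>n\<le>K. c n powr q / \<Lambda> n * ((\<Lambda> n / \<Lambda> K) powr (1/2) * \<Lambda> K))"
          using c by (intro low) auto
        also have "\<dots> \<le> C1 * (\<Sum>n\<le>K. exp p * (c n powr q / \<Lambda> n * T n))"
        proof (intro mult_left_mono sum_mono)
          fix n assume n: "n \<in> {..K}"
          have "p * (\<Lambda> K * x) \<le> p * 1"
            using below[of K] Suc q by (intro mult_left_mono) auto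
          then have "1 \<le> exp p * exp (- (p * \<Lambda> K * x))"
            by (simp add: exp_add[symmetric] mult.assoc)
          then have "\<Lambda> K * 1 \<le> \<Lambda> K * (exp p * exp (- (p * \<Lambda> K * x)))"
            using \<Lambda>[of K] by (intro mult_left_mono) auto
          then have "\<Lambda> K \<le> exp p * E K" by (simp add: E_def mult_ac)
          then have "(\<Lambda> n / \<Lambda> K) powr (1/2) * \<Lambda> K \<le> (\<Lambda> n / \<Lambda> K) powr (1/2) * (exp p * E K)"
            by (rule mult_left_mono) simp
          also have "\<dots> = exp p * ((\<Lambda> n / \<Lambda> K) powr (1/2) * E K)" by simp
          also have "\<dots> \<le> exp p * T n"
            using n Suc J(2) by (intro mult_left_mono T_ge) auto
          finally have "c n powr q / \<Lambda> n * ((\<Lambda> n / \<Lambda> K) powr (1/2) * \<Lambda> K) \<le> c n powr q / \<Lambda> n * (exp p * T n)"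
            using \<Lambda>[of n] by (intro mult_left_mono) auto
          then show "c n powr q / \<Lambda> n * ((\<Lambda> n / \<Lambda> K) powr (1/2) * \<Lambda> K) \<le> exp p * (c n powr q / \<Lambda> n * T n)"
            by (simp add: mult_ac)
        qed (use C1 in auto)
        also have "\<dots> = C1 * exp p * (\<Sum>n\<le>K. c n powr q / \<Lambda> n * T n)"
          by (simp only: sum_distrib_left[symmetric] mult.assoc)
        also have "\<dots> \<le> C1 * exp p * ?S"
          unfolding S using C1 term0 Suc J(2) by (intro mult_left_mono sum_mono2) auto
        finally show ?thesis .
      qed
      show "v powr q \<le> C2 * ?S"
      proof (cases "J = L")
        case True
        then show ?thesis using S0 C2 by (simp add: v_def)
      next
        case False
        then have "v powr q \<le> C2 * (\<Sum>n\<in>{J..<L}. c n powr q / \<Lambda> n * E n)"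
          unfolding v_def E_def using c x J by (intro high) auto
        also have "\<dots> \<le> C2 * (\<Sum>n\<in>{J..<L}. c n powr q / \<Lambda> n * T n)"
        proof (intro mult_left_mono sum_mono)
          fix n assume n: "n \<in> {J..<L}"
          show "E n \<le> T n"
            using T_ge[of n n] n \<Lambda>[of n] by simp
        qed (use C2 \<Lambda> in \<open>auto simp: less_imp_le\<close>)
        also have "\<dots> \<le> C2 * ?S"
          unfolding S using C2 term0 by (intro mult_left_mono sum_mono2) auto
        finally show ?thesis .
      qed
    qed auto
    also have "\<dots> = C * ?S" by (simp add: C_def algebra_simps)
    finally show ?thesis .
  qed
  show ?thesis
    by (intro exI[of _ C] conjI[OF \<open>0 < C\<close>] allI impI) (rule main; assumption)
qed

text \<open>The pointwise bound at \<open>x = - ln t\<close> is integrated termwise: each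
  \<open>E k\<close> has integral at most \<open>S\<close>, and the weights
  \<open>(\<Lambda> n / \<Lambda> k) powr (1/2)\<close> with \<open>k \<ge> n\<close> sum to at most
  \<open>R / (R - 1)\<close> for every \<open>n\<close>. \<open>C\<close> is chosen before
  \<open>\<mu>\<close>, which keeps it independent of the measure.\<close>

lemma muntz_polynomial_upper_bound:
  assumes r: "1 < r" and q: "1 \<le> p" "p < q" and lac: "lacunary r \<Lambda>"
  shows "\<exists>C>0. \<forall>(\<mu> :: real measure) S (a :: nat \<Rightarrow> complex) L.
    finite_measure \<mu> \<longrightarrow> sets \<mu> = sets (restrict_space borel {0..<1}) \<longrightarrow>
    (\<forall>n. \<Lambda> n * (\<integral>t. t powr (p * \<Lambda> n) \<partial>\<mu>) \<le> S) \<longrightarrow>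
    integrable \<mu> (\<lambda>t. norm (\<Sum>n<L. a n * of_real (t powr \<Lambda> n)) powr q) \<and>
    (\<integral>t. norm (\<Sum>n<L. a n * of_real (t powr \<Lambda> n)) powr q \<partial>\<mu>) \<le> C * S * (\<Sum>n<L. norm (a n) powr q / \<Lambda> n)"
proof -
  have \<Lambda>: "0 < \<Lambda> n" for n using lacunary_pos[OF lac] .
  obtain C where C: "0 < C" and "\<forall>c x L. (\<forall>n. 0 \<le> c n) \<longrightarrow> 0 < x \<longrightarrow>
    (\<Sum>n<L. c n * exp (- (\<Lambda> n * x))) powr q
      \<le> C * (\<Sum>n<L. c n powr q / \<Lambda> n *
          (\<Sum>k\<in>{n..<L}. (\<Lambda> n / \<Lambda> k) powr (1/2) * (\<Lambda> k * exp (- (p * \<Lambda> k * x)))))"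
    using exp_sum_powr_le[OF r q lac] by (elim exE conjE) (rule that)
  note pointwise = this(2)[rule_format]
  define R where "R = r powr (1/2)"
  have R: "1 < R" using r by (simp add: R_def)
  have lac': "lacunary R (\<lambda>n. \<Lambda> n powr (1/2))"
    using lacunary_powr[OF lac, of "1/2" 1] r by (simp add: R_def)
  define D where "D = C * (R / (R - 1))"
  have "0 < D" using C R by (simp add: D_def)
  have main: "integrable \<mu> (\<lambda>t. norm (\<Sum>n<L. a n * of_real (t powr \<Lambda> n)) powr q) \<and>
    (\<integral>t. norm (\<Sum>n<L. a n * of_real (t powr \<Lambda> n)) powr q \<partial>\<mu>) \<le> D * S * (\<Sum>n<L. norm (a n) powr q / \<Lambda> n)"
    if fin: "finite_measure \<mu>" and sets: "sets \<mu> = sets (restrict_space borel {0..<1})"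
      and S: "\<forall>n. \<Lambda> n * (\<integral>t. t powr (p * \<Lambda> n) \<partial>\<mu>) \<le> S"
    for \<mu> :: "real measure" and S and a :: "nat \<Rightarrow> complex" and L
  proof
    interpret finite_measure \<mu> by (rule fin)
    have space: "space \<mu> = {0..<1}"
      using sets_eq_imp_space_eq[OF sets] by (simp add: space_restrict_space)
    have meas: "f \<in> borel_measurable \<mu>" if "f \<in> borel_measurable borel" for f :: "real \<Rightarrow> real"
      using that by (subst measurable_cong_sets[OF sets refl]) (rule measurable_restrict_space1)
    have int: "integrable \<mu> (\<lambda>t. t powr (p * \<Lambda> k))" for k
      using \<Lambda>[of k] q
      by (intro integrable_const_bound[of _ 1] AE_I2 meas) (auto simp: space powr_le1)
    show int_f: "integrable \<mu> (\<lambda>t. norm (\<Sum>n<L. a n * of_real (t powr \<Lambda> n)) powr q)"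
    proof (intro integrable_const_bound[of _ "(\<Sum>n<L. norm (a n)) powr q"] AE_I2 meas)
      fix t assume "t \<in> space \<mu>"
      then have "norm (\<Sum>n<L. a n * of_real (t powr \<Lambda> n)) \<le> (\<Sum>n<L. norm (a n))"
        using \<Lambda> by (intro norm_muntz_polynomial_le) (auto simp: space)
      then show "norm (norm (\<Sum>n<L. a n * of_real (t powr \<Lambda> n)) powr q) \<le> (\<Sum>n<L. norm (a n)) powr q"
        using q by (auto intro!: powr_mono2)
    qed measurable
    define E where "E k t = \<Lambda> k * t powr (p * \<Lambda> k)" for k and t :: real
    have E_int: "integrable \<mu> (E k)" for k
      unfolding E_def using int by simp
    have "(\<integral>t. norm (\<Sum>n<L. a n * of_real (t powr \<Lambda> n)) powr q \<partial>\<mu>)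
      \<le> (\<integral>t. C * (\<Sum>n<L. norm (a n) powr q / \<Lambda> n * (\<Sum>k\<in>{n..<L}. (\<Lambda> n / \<Lambda> k) powr (1/2) * E k t)) \<partial>\<mu>)"
    proof (rule integral_mono)
      fix t assume "t \<in> space \<mu>"
      then have t: "0 \<le> t" "t < 1" by (auto simp: space)
      show "norm (\<Sum>n<L. a n * of_real (t powr \<Lambda> n)) powr q
        \<le> C * (\<Sum>n<L. norm (a n) powr q / \<Lambda> n * (\<Sum>k\<in>{n..<L}. (\<Lambda> n / \<Lambda> k) powr (1/2) * E k t))"
      proof (cases "t = 0")
        \<comment> \<open>No \<open>x\<close> corresponds to \<open>t = 0\<close>; there
          \<open>0 powr s = 0\<close> makes both sides vanish.\<close>
        case True
        then show ?thesis by (simp add: E_def)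
      next
        case False
        define x where "x = - ln t"
        have x: "0 < x" using t False by (simp add: x_def)
        have powr: "t powr s = exp (- (s * x))" for s
          using t False by (simp add: powr_def x_def)
        have "norm (\<Sum>n<L. a n * of_real (t powr \<Lambda> n)) \<le> (\<Sum>n<L. norm (a n) * exp (- (\<Lambda> n * x)))"
          by (intro sum_norm_le) (simp add: norm_mult powr)
        then have "norm (\<Sum>n<L. a n * of_real (t powr \<Lambda> n)) powr q \<le> (\<Sum>n<L. norm (a n) * exp (- (\<Lambda> n * x))) powr q"
          using q by (intro powr_mono2) auto
        also have "\<dots> \<le> C * (\<Sum>n<L. norm (a n) powr q / \<Lambda> n *
          (\<Sum>k\<in>{n..<L}. (\<Lambda> n / \<Lambda> k) powr (1/2) * (\<Lambda> k * exp (- (p * \<Lambda> k * x)))))"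
          using x by (intro pointwise) auto
        finally show ?thesis
          by (simp only: E_def powr)
      qed
    qed (use int_f E_int in auto)
    also have "\<dots> = C * (\<Sum>n<L. norm (a n) powr q / \<Lambda> n * (\<Sum>k\<in>{n..<L}. (\<Lambda> n / \<Lambda> k) powr (1/2) * (\<integral>t. E k t \<partial>\<mu>)))"
      using E_int by simp
    also have "\<dots> \<le> C * (\<Sum>n<L. norm (a n) powr q / \<Lambda> n * (R / (R - 1) * S))"
    proof (intro mult_left_mono sum_mono)
      fix n
      have "0 \<le> \<Lambda> 0 * (\<integral>t. t powr (p * \<Lambda> 0) \<partial>\<mu>)"
        using \<Lambda>[of 0] by (intro mult_nonneg_nonneg Bochner_Integration.integral_nonneg) auto
      then have S0: "0 \<le> S" using S by (meson order_trans)
      have "(\<Sum>k\<in>{n..<L}. (\<Lambda> n / \<Lambda> k) powr (1/2) * (\<integral>t. E k t \<partial>\<mu>)) \<le> (\<Sum>k\<in>{n..<L}. (\<Lambda> n / \<Lambda> k) powr (1/2) * S)"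
        using S by (intro sum_mono mult_left_mono) (auto simp: E_def)
      also have "\<dots> = \<Lambda> n powr (1/2) * S * (\<Sum>k\<in>{n..<L}. 1 / \<Lambda> k powr (1/2))"
        using \<Lambda> by (simp add: sum_distrib_left powr_divide less_imp_le mult_ac)
      also have "\<dots> \<le> \<Lambda> n powr (1/2) * S * (R / (R - 1) / \<Lambda> n powr (1/2))"
        using S0 by (intro mult_left_mono lacunary_sum_inverse_le[OF lac' R]) auto
      also have "\<dots> = R / (R - 1) * S"
        using \<Lambda>[of n] by simp
      finally show "(\<Sum>k\<in>{n..<L}. (\<Lambda> n / \<Lambda> k) powr (1/2) * (\<integral>t. E k t \<partial>\<mu>)) \<le> R / (R - 1) * S" .
    qed (use C \<Lambda> in \<open>auto simp: less_imp_le\<close>)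
    also have "\<dots> = D * S * (\<Sum>n<L. norm (a n) powr q / \<Lambda> n)"
      unfolding D_def sum_distrib_right[symmetric] by (simp only: mult_ac)
    finally show "(\<integral>t. norm (\<Sum>n<L. a n * of_real (t powr \<Lambda> n)) powr q \<partial>\<mu>) \<le> D * S * (\<Sum>n<L. norm (a n) powr q / \<Lambda> n)" .
  qed
  show ?thesis
    by (intro exI[of _ D] conjI[OF \<open>0 < D\<close>] allI impI) (rule main; assumption)
qed

section \<open>Norms expressed through integrals\<close>

lemma Lq_norm_le:
  assumes q: "0 < q" and B: "0 \<le> B" and I: "(\<integral>\<^sup>+ x. ennreal (norm (f x) powr q) \<partial>M) \<le> ennreal B"
  shows "Lq_norm M q f \<le> ennreal (B powr (1 / q))"
proof -
  let ?I = "\<integral>\<^sup>+ x. ennreal (norm (f x) powr q) \<partial>M"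
  have "?I \<noteq> \<infinity>" using I by (auto simp: top_unique)
  moreover have "enn2real ?I \<le> B" using B I by (rule enn2real_leI)
  then have "enn2real ?I powr (1 / q) \<le> B powr (1 / q)"
    using q by (intro powr_mono2) auto
  ultimately show ?thesis
    by (simp add: Lq_norm_def Let_def ennreal_leI)
qed

lemma Lq_norm_eq_integral:
  assumes "integrable M (\<lambda>x. norm (f x) powr q)"
  shows "Lq_norm M q f = ennreal ((\<integral>x. norm (f x) powr q \<partial>M) powr (1 / q))"
proof -
  have "0 \<le> (\<integral>x. norm (f x) powr q \<partial>M)"
    by (rule Bochner_Integration.integral_nonneg) simp
  then show ?thesis
    using nn_integral_eq_integral[OF assms] by (simp add: Lq_norm_def Let_def)
qed

lemma nn_integral_le_1_if_Lq_norm_le_1: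
  assumes q: "0 < q" and f: "Lq_norm M q f \<le> 1"
  shows "(\<integral>\<^sup>+ x. ennreal (norm (f x) powr q) \<partial>M) \<le> 1"
proof -
  define I where "I = (\<integral>\<^sup>+ x. ennreal (norm (f x) powr q) \<partial>M)"
  have L: "Lq_norm M q f = (if I = \<infinity> then \<infinity> else ennreal (enn2real I powr (1 / q)))"
    by (simp add: Lq_norm_def I_def Let_def)
  have fin: "I \<noteq> \<infinity>"
    using f unfolding L by (auto simp: top_unique)
  then have le: "enn2real I powr (1 / q) \<le> 1"
    using f unfolding L by (simp add: ennreal_le_1)
  have "enn2real I \<le> 1"
  proof (rule ccontr)
    assume "\<not> enn2real I \<le> 1"
    then have "1 < enn2real I powr (1 / q)"
      using q by (intro gr_one_powr) auto
    with le show False by simp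
  qed
  then have "ennreal (enn2real I) \<le> 1" by (simp add: ennreal_le_1)
  then show ?thesis
    using fin by (simp add: I_def[symmetric] less_top)
qed

lemma muntz_polynomial_powr_integrable_leb01:
  fixes a :: "nat \<Rightarrow> complex"
  assumes \<Lambda>: "\<And>n. 0 < \<Lambda> n" and q: "0 < q"
  shows "integrable leb01 (\<lambda>t. norm (\<Sum>n<L. a n * of_real (t powr \<Lambda> n)) powr q)"
proof (rule integral_leb01_exp(1))
  fix t :: real assume t: "t \<in> {0..1}"
  show "\<bar>norm (\<Sum>n<L. a n * of_real (t powr \<Lambda> n)) powr q\<bar> \<le> (\<Sum>n<L. norm (a n)) powr q"
    using q norm_muntz_polynomial_le[of \<Lambda> t a L, OF \<Lambda> t] by (auto intro!: powr_mono2)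
qed measurable

section \<open>From polynomials to general elements of the Muntz space\<close>

text \<open>With \<open>x = - ln y\<close>, the inequality \<open>exp (- u) \<le> 1 / u\<close> at
  \<open>u = \<Lambda> n * x\<close> reduces the claim to the summability of
  \<open>1 / \<Lambda> n\<close>.\<close>

lemma lacunary_summable_powr:
  assumes lac: "lacunary r \<Lambda>" and r: "1 < r" and y: "0 < y" "y < 1"
  shows "summable (\<lambda>n. y powr \<Lambda> n)"
proof -
  have \<Lambda>: "0 < \<Lambda> n" for n using lacunary_pos[OF lac] .
  define x where "x = - ln y"
  have x: "0 < x" using y by (simp add: x_def)
  have "summable (\<lambda>n. 1 / \<Lambda> n)"
    using lacunary_sum_inverse_le[OF lac r, of 0] \<Lambda>
    by (intro summableI_nonneg_bounded[of _ "r / (r - 1) / \<Lambda> 0"])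
      (auto simp: less_imp_le lessThan_atLeast0)
  then have "summable (\<lambda>n. 1 / x * (1 / \<Lambda> n))"
    by (rule summable_mult)
  moreover have "norm (y powr \<Lambda> n) \<le> 1 / x * (1 / \<Lambda> n)" for n
  proof -
    have "\<Lambda> n * x \<le> exp (\<Lambda> n * x)"
      using exp_ge_add_one_self[of "\<Lambda> n * x"] by linarith
    then have "1 / exp (\<Lambda> n * x) \<le> 1 / (\<Lambda> n * x)"
      using x \<Lambda>[of n] by (intro divide_left_mono) auto
    moreover have "y powr \<Lambda> n = 1 / exp (\<Lambda> n * x)"
      using y by (simp add: powr_def x_def exp_minus[symmetric] inverse_eq_divide[symmetric])
    ultimately show ?thesis
      by (simp add: mult.commute)
  qed
  ultimately show ?thesis
    by (rule summable_comparison_test'[where N = 0])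
qed

text \<open>Abel's argument: convergence at a point \<open>\<sigma>\<close> strictly between
  \<open>\<rho>\<close> and \<open>1\<close> bounds the terms there by some \<open>B\<close>, and
  descending from \<open>\<sigma>\<close> to \<open>\<rho> * t\<close> gains the summable factor
  \<open>(\<rho> / \<sigma>) powr \<Lambda> n\<close>. The Weierstrass test then applies.\<close>

lemma muntz_series_uniform_limit:
  fixes a :: "nat \<Rightarrow> complex"
  assumes lac: "lacunary r \<Lambda>" and r: "1 < r" and \<rho>: "0 < \<rho>" "\<rho> < 1"
    and f: "\<And>x. x \<in> {0..<1} \<Longrightarrow> (\<lambda>n. a n * complex_of_real (x powr \<Lambda> n)) sums f x"
  shows "uniform_limit {0..1} (\<lambda>N t. \<Sum>n<N. a n * of_real ((\<rho> * t) powr \<Lambda> n)) (\<lambda>t. f (\<rho> * t)) sequentially"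
proof -
  have \<Lambda>: "0 < \<Lambda> n" for n using lacunary_pos[OF lac] .
  define \<sigma> where "\<sigma> = (1 + \<rho>) / 2"
  have \<sigma>: "0 < \<sigma>" "\<sigma> < 1" "\<rho> < \<sigma>" using \<rho> by (auto simp: \<sigma>_def)
  have "(\<lambda>n. a n * complex_of_real (\<sigma> powr \<Lambda> n)) \<longlonglongrightarrow> 0"
    using \<sigma> by (intro summable_LIMSEQ_zero sums_summable[OF f]) auto
  then have "Bseq (\<lambda>n. a n * complex_of_real (\<sigma> powr \<Lambda> n))"
    by (intro convergent_imp_Bseq convergentI)
  then obtain B where B: "norm (a n * complex_of_real (\<sigma> powr \<Lambda> n)) \<le> B" for n
    unfolding Bseq_def by blast
  have bound: "norm (a n * of_real ((\<rho> * t) powr \<Lambda> n)) \<le> B * (\<rho> / \<sigma>) powr \<Lambda> n" if "t \<in> {0..1}" for n t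
  proof -
    have "(\<rho> * t) powr \<Lambda> n \<le> \<rho> powr \<Lambda> n"
      using \<rho> \<Lambda>[of n] that by (intro powr_mono2) (auto simp: mult_left_le)
    also have "\<dots> = \<sigma> powr \<Lambda> n * (\<rho> / \<sigma>) powr \<Lambda> n"
      using \<sigma> \<rho> by (simp add: powr_divide)
    finally have "norm (a n) * (\<rho> * t) powr \<Lambda> n \<le> norm (a n) * (\<sigma> powr \<Lambda> n * (\<rho> / \<sigma>) powr \<Lambda> n)"
      by (rule mult_left_mono) simp
    also have "\<dots> = norm (a n * complex_of_real (\<sigma> powr \<Lambda> n)) * (\<rho> / \<sigma>) powr \<Lambda> n"
      by (simp add: norm_mult)
    also have "\<dots> \<le> B * (\<rho> / \<sigma>) powr \<Lambda> n"
      by (intro mult_right_mono B) simp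
    finally show ?thesis by (simp add: norm_mult)
  qed
  have "summable (\<lambda>n. B * (\<rho> / \<sigma>) powr \<Lambda> n)"
    using \<rho> \<sigma> by (intro summable_mult lacunary_summable_powr[OF lac r]) auto
  then have "uniform_limit {0..1} (\<lambda>N t. \<Sum>n<N. a n * complex_of_real ((\<rho> * t) powr \<Lambda> n))
    (\<lambda>t. \<Sum>n. a n * complex_of_real ((\<rho> * t) powr \<Lambda> n)) sequentially"
    by (rule Weierstrass_m_test[rotated]) (rule bound)
  then show ?thesis
  proof (rule uniform_limit_cong'[THEN iffD1, rotated 2])
    show "(\<Sum>n. a n * of_real ((\<rho> * t) powr \<Lambda> n)) = f (\<rho> * t)" if "t \<in> {0..1}" for t
    proof -
      have "\<rho> * t \<le> \<rho> * 1" using that \<rho> by (intro mult_left_mono) auto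
      then have "\<rho> * t < 1" using \<rho> by linarith
      then show ?thesis
        using that \<rho> by (intro sums_unique[symmetric] f) auto
    qed
  qed simp
qed

text \<open>Substituting \<open>\<rho> * t\<close> costs the factor
  \<open>1 / \<rho> \<le> 2\<close>, and the constant \<open>1\<close> has integral \<open>1\<close>
  over the unit interval; together this is the \<open>3\<close>.\<close>

lemma nn_integral_leb01_dilation_le:
  fixes h :: "real \<Rightarrow> ennreal"
  assumes h: "h \<in> borel_measurable leb01" and \<rho>: "1 / 2 \<le> \<rho>" "\<rho> \<le> 1"
    and I: "(\<integral>\<^sup>+ t. h t \<partial>leb01) \<le> 1"
    and g: "\<And>t. t \<in> {0..1} \<Longrightarrow> g t \<le> c * (h (\<rho> * t) + 1)"
  shows "(\<integral>\<^sup>+ t. g t \<partial>leb01) \<le> c * 3"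
proof -
  \<comment> \<open>Extension by zero, so that the affine substitution can be made on the whole
    line.\<close>
  define H where "H t = h t * indicator {0..1} t" for t
  have H[measurable]: "H \<in> borel_measurable borel"
    using h unfolding H_def leb01_def by (subst (asm) borel_measurable_restrict_space_iff_ennreal) auto
  have HI: "(\<integral>\<^sup>+ t. H t \<partial>lborel) \<le> 1"
    using I by (simp add: H_def leb01_def nn_integral_restrict_space)
  define X where "X = (\<integral>\<^sup>+ t. H (\<rho> * t) \<partial>lborel)"
  have "ennreal (1 / 2) * X \<le> ennreal \<rho> * X"
    using \<rho> by (intro mult_right_mono ennreal_leI) auto
  also have "\<dots> \<le> 1"
    using nn_integral_real_affine[OF H, of \<rho> 0] \<rho> HI by (simp add: X_def)
  finally have "ennreal 2 * (ennreal (1 / 2) * X) \<le> ennreal 2 * 1"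
    by (rule mult_left_mono) simp
  moreover have "ennreal 2 * ennreal (1 / 2) = 1"
    by (subst ennreal_mult[symmetric]) auto
  ultimately have X: "X \<le> 2"
    by (simp only: mult.assoc[symmetric]) simp
  have "(\<integral>\<^sup>+ t. g t \<partial>leb01) = (\<integral>\<^sup>+ t. g t * indicator {0..1} t \<partial>lborel)"
    by (simp add: leb01_def nn_integral_restrict_space)
  also have "\<dots> \<le> (\<integral>\<^sup>+ t. c * (H (\<rho> * t) + indicator {0..1} t) \<partial>lborel)"
  proof (rule nn_integral_mono)
    fix t :: real
    show "g t * indicator {0..1} t \<le> c * (H (\<rho> * t) + indicator {0..1} t)"
    proof (cases "t \<in> {0..1}")
      case True
      then have "\<rho> * t \<in> {0..1}" using \<rho> by (auto simp: mult_le_one)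
      then show ?thesis using g[OF True] True by (simp add: H_def)
    qed simp
  qed
  also have "\<dots> = c * (X + 1)"
    unfolding X_def by (subst nn_integral_cmult, measurable) (subst nn_integral_add, auto)
  also have "\<dots> \<le> c * (2 + 1)"
    using X by (intro mult_left_mono add_right_mono) auto
  finally show ?thesis by simp
qed

text \<open>The dilate \<open>f (\<rho> * t)\<close> is a uniform limit of polynomials with
  coefficients \<open>a n * \<rho> powr \<Lambda> n\<close>, to which the lower bound applies. With
  \<open>\<rho>\<close> close enough to \<open>1\<close>, depending on \<open>M\<close>, the first
  \<open>M\<close> terms lose at most a factor \<open>2\<close>, so the final bound is independent
  of \<open>M\<close>.\<close>

lemma muntz_series_coefficient_bound:
  fixes a :: "nat \<Rightarrow> complex"
  assumes lac: "lacunary r \<Lambda>" and r: "1 < r" and q: "1 \<le> q" and C: "0 < C"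
    and lower: "\<And>(b :: nat \<Rightarrow> complex) L. (\<Sum>n<L. norm (b n) powr q / \<Lambda> n)
      \<le> C * (\<integral>t. norm (\<Sum>n<L. b n * of_real (t powr \<Lambda> n)) powr q \<partial>leb01)"
    and fm: "f \<in> borel_measurable leb01"
    and fI: "(\<integral>\<^sup>+ t. ennreal (norm (f t) powr q) \<partial>leb01) \<le> 1"
    and f: "\<And>x. x \<in> {0..<1} \<Longrightarrow> (\<lambda>n. a n * complex_of_real (x powr \<Lambda> n)) sums f x"
  shows "(\<Sum>n<M. norm (a n) powr q / \<Lambda> n) \<le> 2 * (C * (2 powr (q - 1) * 3))"
proof -
  have \<Lambda>: "0 < \<Lambda> n" for n using lacunary_pos[OF lac] .
  define s where "s = q * \<Lambda> M"
  have s: "0 < s" using q \<Lambda>[of M] by (simp add: s_def)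
  \<comment> \<open>The second entry ensures \<open>\<rho> powr s \<ge> 1 / 2\<close>, so that
    \<open>norm (a n) powr q\<close> is at most halved for \<open>n < M\<close>; the first entry
    meets the hypothesis of \<open>nn_integral_leb01_dilation_le\<close>.\<close>
  define \<rho> where "\<rho> = max (1 / 2) ((1 / 2) powr (1 / s))"
  have "(1 / 2) powr (1 / s) < (1::real)"
    using s powr_less_mono2[of "1 / s" "1 / 2" 1] by simp
  then have \<rho>: "1 / 2 \<le> \<rho>" "0 < \<rho>" "\<rho> < 1" by (auto simp: \<rho>_def less_max_iff_disj)
  have "((1 / 2) powr (1 / s)) powr s \<le> \<rho> powr s"
    using s by (intro powr_mono2) (auto simp: \<rho>_def)
  then have \<rho>s: "1 / 2 \<le> \<rho> powr s" using s by (simp add: powr_powr)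
  define P where "P N t = (\<Sum>n<N. a n * complex_of_real ((\<rho> * t) powr \<Lambda> n))" for N t
  have "uniform_limit {0..1} P (\<lambda>t. f (\<rho> * t)) sequentially"
    unfolding P_def using \<rho>(2,3) f by (rule muntz_series_uniform_limit[OF lac r])
  then have "eventually (\<lambda>N. \<forall>t\<in>{0..1}. dist (P N t) (f (\<rho> * t)) < 1) sequentially"
    by (rule uniform_limitD) simp
  \<comment> \<open>Distance \<open>1\<close> is close enough, since it only enters the constant;
    \<open>M \<le> N\<close> puts the coefficients in question among those of the
    polynomial.\<close>
  then obtain N where N: "M \<le> N" "\<And>t. t \<in> {0..1} \<Longrightarrow> dist (P N t) (f (\<rho> * t)) < 1"
    unfolding eventually_sequentially by (metis nle_le)
  define b where "b n = a n * of_real (\<rho> powr \<Lambda> n)" for n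
  have Pb: "P N t = (\<Sum>n<N. b n * of_real (t powr \<Lambda> n))" if "t \<in> {0..1}" for t
    using that \<rho> by (auto simp: P_def b_def powr_mult intro!: sum.cong)
  let ?I = "\<integral>t. norm (\<Sum>n<N. b n * of_real (t powr \<Lambda> n)) powr q \<partial>leb01"
  have "ennreal ?I = (\<integral>\<^sup>+ t. ennreal (norm (\<Sum>n<N. b n * of_real (t powr \<Lambda> n)) powr q) \<partial>leb01)"
    using q \<Lambda> by (intro nn_integral_eq_integral[symmetric] muntz_polynomial_powr_integrable_leb01) auto
  also have "\<dots> \<le> ennreal (2 powr (q - 1)) * 3"
  proof (rule nn_integral_leb01_dilation_le[OF _ \<rho>(1) less_imp_le[OF \<rho>(3)] fI])
    fix t :: real assume t: "t \<in> {0..1}"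
    have "norm (\<Sum>n<N. b n * of_real (t powr \<Lambda> n)) \<le> norm (f (\<rho> * t)) + 1"
      using N(2)[OF t] norm_triangle_sub[of "P N t" "f (\<rho> * t)"] by (simp add: Pb[OF t] dist_norm)
    then have "norm (\<Sum>n<N. b n * of_real (t powr \<Lambda> n)) powr q \<le> (norm (f (\<rho> * t)) + 1) powr q"
      using q by (intro powr_mono2) auto
    also have "\<dots> \<le> 2 powr (q - 1) * (norm (f (\<rho> * t)) powr q + 1)"
      using add_powr_le[of q "norm (f (\<rho> * t))" 1] q by simp
    finally show "ennreal (norm (\<Sum>n<N. b n * of_real (t powr \<Lambda> n)) powr q)
      \<le> ennreal (2 powr (q - 1)) * (ennreal (norm (f (\<rho> * t)) powr q) + 1)"
      by (simp add: ennreal_leI ennreal_mult[symmetric] ennreal_plus[symmetric] del: ennreal_plus flip: ennreal_1)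
  qed (use fm in measurable)
  also have "\<dots> = ennreal (2 powr (q - 1) * 3)"
    by (simp add: ennreal_mult)
  finally have I: "?I \<le> 2 powr (q - 1) * 3"
    by (simp add: ennreal_le_iff)
  have "(\<Sum>n<M. norm (a n) powr q / \<Lambda> n) \<le> (\<Sum>n<M. 2 * (norm (b n) powr q / \<Lambda> n))"
  proof (rule sum_mono)
    fix n assume n: "n \<in> {..<M}"
    have "q * \<Lambda> n \<le> s"
      unfolding s_def using n q lacunary_mono[OF lac r, of n M] by (intro mult_left_mono) auto
    then have "\<rho> powr s \<le> \<rho> powr (q * \<Lambda> n)"
      using \<rho> by (intro powr_mono') auto
    then have "1 \<le> 2 * \<rho> powr (q * \<Lambda> n)" using \<rho>s by simp
    then have "norm (a n) powr q / \<Lambda> n * 1 \<le> norm (a n) powr q / \<Lambda> n * (2 * \<rho> powr (q * \<Lambda> n))"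
      using \<Lambda>[of n] by (intro mult_left_mono) auto
    also have "norm (b n) powr q = norm (a n) powr q * \<rho> powr (q * \<Lambda> n)"
      by (simp add: b_def norm_mult powr_mult powr_powr mult.commute)
    then have "norm (a n) powr q / \<Lambda> n * (2 * \<rho> powr (q * \<Lambda> n)) = 2 * (norm (b n) powr q / \<Lambda> n)"
      by simp
    finally show "norm (a n) powr q / \<Lambda> n \<le> 2 * (norm (b n) powr q / \<Lambda> n)" by simp
  qed
  also have "\<dots> = 2 * (\<Sum>n<M. norm (b n) powr q / \<Lambda> n)"
    by (simp only: sum_distrib_left)
  also have "\<dots> \<le> 2 * (\<Sum>n<N. norm (b n) powr q / \<Lambda> n)"
    using N(1) \<Lambda> by (intro mult_left_mono sum_mono2) (auto simp: less_imp_le)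
  also have "\<dots> \<le> 2 * (C * ?I)"
    by (intro mult_left_mono lower) auto
  also have "\<dots> \<le> 2 * (C * (2 powr (q - 1) * 3))"
    using C I by (intro mult_left_mono) auto
  finally show ?thesis .
qed

section \<open>The Carleson property and the norm of the embedding\<close>

theorem theorem4p5:
  fixes \<Lambda> :: "nat \<Rightarrow> real" and r p q :: real
  assumes "1 < r" and "lacunary r \<Lambda>" and "1 \<le> p" and "p < q"
  shows "\<exists>C>0. \<forall>\<mu> :: real measure.
           finite_measure \<mu> \<and> sets \<mu> = sets (restrict_space borel {0..<1}) \<and> cond_B p \<Lambda> \<mu> \<longrightarrow>
           carleson_measure \<Lambda> q \<mu> \<and>
           embedding_norm \<Lambda> q \<mu>
             \<le> ennreal (C * (SUP n. \<Lambda> n * (LINT t|\<mu>. t powr (p * \<Lambda> n))) powr (1 / q))"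
proof -
  note r = assms(1) and lac = assms(2)
  have q: "1 \<le> q" "0 < q" using assms by auto
  have \<Lambda>: "0 < \<Lambda> n" for n using lacunary_pos[OF lac] .
  obtain C1 where C1: "0 < C1" and "\<forall>(a :: nat \<Rightarrow> complex) L. (\<Sum>n<L. norm (a n) powr q / \<Lambda> n)
      \<le> C1 * (\<integral>t. norm (\<Sum>n<L. a n * of_real (t powr \<Lambda> n)) powr q \<partial>leb01)"
    using muntz_polynomial_lower_bound[OF r q(1) lac] by (elim exE conjE) (rule that)
  note lower = this(2)[rule_format]
  obtain C2 where C2: "0 < C2" and "\<forall>(\<mu> :: real measure) S (a :: nat \<Rightarrow> complex) L.
    finite_measure \<mu> \<longrightarrow> sets \<mu> = sets (restrict_space borel {0..<1}) \<longrightarrow>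
    (\<forall>n. \<Lambda> n * (\<integral>t. t powr (p * \<Lambda> n) \<partial>\<mu>) \<le> S) \<longrightarrow>
    integrable \<mu> (\<lambda>t. norm (\<Sum>n<L. a n * of_real (t powr \<Lambda> n)) powr q) \<and>
    (\<integral>t. norm (\<Sum>n<L. a n * of_real (t powr \<Lambda> n)) powr q \<partial>\<mu>) \<le> C2 * S * (\<Sum>n<L. norm (a n) powr q / \<Lambda> n)"
    using muntz_polynomial_upper_bound[OF r assms(3,4) lac] by (elim exE conjE) (rule that)
  note upper = this(2)[rule_format]
  \<comment> \<open>The bound from \<open>muntz_series_coefficient_bound\<close> for the
    coefficients of functions in the unit ball. Like \<open>C1\<close> and \<open>C2\<close>, it is
    fixed before the measure.\<close>
  define D where "D = 2 * (C1 * (2 powr (q - 1) * 3))"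
  have "0 < D" using C1 by (simp add: D_def)
  have main: "carleson_measure \<Lambda> q \<mu> \<and> embedding_norm \<Lambda> q \<mu>
      \<le> ennreal ((C2 * D) powr (1 / q) * (SUP n. \<Lambda> n * (LINT t|\<mu>. t powr (p * \<Lambda> n))) powr (1 / q))"
    if fin: "finite_measure \<mu>" and sets: "sets \<mu> = sets (restrict_space borel {0..<1})" and cond: "cond_B p \<Lambda> \<mu>"
    for \<mu> :: "real measure"
  proof -
    define S where "S = (SUP n. \<Lambda> n * (LINT t|\<mu>. t powr (p * \<Lambda> n)))"
    have space: "space \<mu> = {0..<1}"
      using sets_eq_imp_space_eq[OF sets] by (simp add: space_restrict_space)
    obtain C' where C': "\<And>n. (LINT t|\<mu>. t powr (p * \<Lambda> n)) \<le> C' / \<Lambda> n"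
      using cond by (auto simp: cond_B_def)
    have "\<Lambda> n * (LINT t|\<mu>. t powr (p * \<Lambda> n)) \<le> C'" for n
      using C'[of n] \<Lambda>[of n] by (simp add: pos_le_divide_eq mult.commute)
    \<comment> \<open>The supremum of a set of reals is known to be an upper bound only if the set
      is bounded above; \<open>cond_B\<close> provides this.\<close>
    then have "bdd_above (range (\<lambda>n. \<Lambda> n * (LINT t|\<mu>. t powr (p * \<Lambda> n))))"
      by (intro bdd_aboveI2)
    then have S: "\<Lambda> n * (LINT t|\<mu>. t powr (p * \<Lambda> n)) \<le> S" for n
      unfolding S_def by (intro cSUP_upper) auto
    have "0 \<le> \<Lambda> 0 * (LINT t|\<mu>. t powr (p * \<Lambda> 0))"
      using \<Lambda>[of 0] by (intro mult_nonneg_nonneg Bochner_Integration.integral_nonneg) auto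
    then have S0: "0 \<le> S" using S by (rule order_trans)
    note up = upper[OF fin sets S]
    have "carleson_measure \<Lambda> q \<mu>"
      unfolding carleson_measure_def
    \<comment> \<open>The Carleson constant is left open here and becomes
      \<open>(C2 * S * C1) powr (1 / q)\<close> in the closing \<open>show\<close>.\<close>
    proof (intro exI ballI)
      fix f assume "f \<in> muntz_polynomials \<Lambda>"
      then obtain a L where f: "f = (\<lambda>t. \<Sum>n<L. a n * complex_of_real (t powr \<Lambda> n))"
        by (auto simp: muntz_polynomials_def)
      let ?I = "\<integral>t. norm (f t) powr q \<partial>leb01"
      have I0: "0 \<le> ?I" by (rule Bochner_Integration.integral_nonneg) simp
      have "(\<integral>t. norm (f t) powr q \<partial>\<mu>) \<le> C2 * S * (\<Sum>n<L. norm (a n) powr q / \<Lambda> n)"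
        unfolding f using up by blast
      also have "\<dots> \<le> C2 * S * (C1 * ?I)"
        unfolding f using C2 S0 lower[of a L] by (intro mult_left_mono) auto
      finally have "(\<integral>t. norm (f t) powr q \<partial>\<mu>) powr (1 / q) \<le> (C2 * S * (C1 * ?I)) powr (1 / q)"
        using q by (intro powr_mono2 Bochner_Integration.integral_nonneg) auto
      also have "\<dots> = (C2 * S * C1) powr (1 / q) * ?I powr (1 / q)"
        using C1 C2 S0 I0 by (subst powr_mult[symmetric]) (auto simp: mult.assoc)
      finally have "ennreal ((\<integral>t. norm (f t) powr q \<partial>\<mu>) powr (1 / q))
        \<le> ennreal ((C2 * S * C1) powr (1 / q)) * ennreal (?I powr (1 / q))"
        by (simp add: ennreal_mult[symmetric] ennreal_leI)
      moreover have "integrable \<mu> (\<lambda>t. norm (f t) powr q)"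
        unfolding f using up by blast
      moreover have "integrable leb01 (\<lambda>t. norm (f t) powr q)"
        unfolding f using \<Lambda> q by (intro muntz_polynomial_powr_integrable_leb01) auto
      ultimately show "Lq_norm \<mu> q f \<le> ennreal ((C2 * S * C1) powr (1 / q)) * Lq_norm leb01 q f"
        by (simp only: Lq_norm_eq_integral)
    qed
    moreover have "embedding_norm \<Lambda> q \<mu> \<le> ennreal ((C2 * D) powr (1 / q) * S powr (1 / q))"
      unfolding embedding_norm_def
    proof (rule SUP_least)
      fix f assume "f \<in> {f \<in> muntz_space \<Lambda> q. Lq_norm leb01 q f \<le> 1}"
      then have fm: "f \<in> borel_measurable leb01" and f1: "Lq_norm leb01 q f \<le> 1"
        and "\<exists>a. \<forall>x\<in>{0..<1}. (\<lambda>n. a n * complex_of_real (x powr \<Lambda> n)) sums f x"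
        by (simp_all add: muntz_space_def)
      then obtain a where fa: "(\<lambda>n. a n * complex_of_real (x powr \<Lambda> n)) sums f x" if "x \<in> {0..<1}" for x
        by metis
      have coeff: "(\<Sum>n<N. norm (a n) powr q / \<Lambda> n) \<le> D" for N
        unfolding D_def
        by (rule muntz_series_coefficient_bound[OF lac r q(1) C1 lower fm
              nn_integral_le_1_if_Lq_norm_le_1[OF q(2) f1] fa])
      define P where "P N t = (\<Sum>n<N. a n * complex_of_real (t powr \<Lambda> n))" for N t
      have P_int: "integrable \<mu> (\<lambda>t. norm (P N t) powr q)" for N
        unfolding P_def using up by blast
      have P_le: "(\<integral>\<^sup>+ t. ennreal (norm (P N t) powr q) \<partial>\<mu>) \<le> ennreal (C2 * D * S)" for N
      proof -
        have "(\<integral>t. norm (P N t) powr q \<partial>\<mu>) \<le> C2 * S * (\<Sum>n<N. norm (a n) powr q / \<Lambda> n)"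
          unfolding P_def using up by blast
        also have "\<dots> \<le> C2 * S * D"
          using C2 S0 by (intro mult_left_mono coeff) auto
        finally show ?thesis
          using nn_integral_eq_integral[OF P_int] by (simp add: ennreal_leI mult_ac)
      qed
      \<comment> \<open>The measure lives on \<open>{0..<1}\<close>, where the partial sums
        \<open>P N\<close> converge to \<open>f\<close> at every point; hence the
        \<open>liminf\<close> is attained everywhere and Fatou's lemma can follow.\<close>
      have "(\<integral>\<^sup>+ t. ennreal (norm (f t) powr q) \<partial>\<mu>)
        = (\<integral>\<^sup>+ t. liminf (\<lambda>N. ennreal (norm (P N t) powr q)) \<partial>\<mu>)"
      proof (rule nn_integral_cong)
        fix t assume "t \<in> space \<mu>"
        then have "(\<lambda>N. P N t) \<longlonglongrightarrow> f t"
          using fa[of t] by (simp add: space P_def sums_def)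
        then have "(\<lambda>N. ennreal (norm (P N t) powr q)) \<longlonglongrightarrow> ennreal (norm (f t) powr q)"
          using q by (intro tendsto_ennrealI tendsto_powr' tendsto_norm tendsto_const) auto
        then show "ennreal (norm (f t) powr q) = liminf (\<lambda>N. ennreal (norm (P N t) powr q))"
          by (intro lim_imp_Liminf[symmetric]) auto
      qed
      also have "\<dots> \<le> liminf (\<lambda>N. \<integral>\<^sup>+ t. ennreal (norm (P N t) powr q) \<partial>\<mu>)"
        using borel_measurable_integrable[OF P_int] by (intro nn_integral_liminf) auto
      also have "\<dots> \<le> liminf (\<lambda>N. ennreal (C2 * D * S))"
        using P_le by (intro Liminf_mono) auto
      also have "\<dots> = ennreal (C2 * D * S)"
        by (simp add: Liminf_const)
      finally have "Lq_norm \<mu> q f \<le> ennreal ((C2 * D * S) powr (1 / q))"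
        using C2 \<open>0 < D\<close> S0 q by (intro Lq_norm_le) auto
      then show "Lq_norm \<mu> q f \<le> ennreal ((C2 * D) powr (1 / q) * S powr (1 / q))"
        using C2 \<open>0 < D\<close> S0 by (simp add: powr_mult)
    qed
    ultimately show ?thesis by (simp only: S_def)
  qed
  have "0 < (C2 * D) powr (1 / q)" using C2 \<open>0 < D\<close> by simp
  then show ?thesis
    using main by (intro exI[of _ "(C2 * D) powr (1 / q)"]) blast
qed

end
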